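(* Let $d\ge1$ and let $A$ be a $d\times d$ integer matrix all of whose complex eigenvalues have the same modulus $\lambda$, with $\lambda>1$. Let $T\colon\mathbb{T}^d\to\mathbb{T}^d$ be $Tx=Ax\pmod 1$. Let $\psi\colon\mathbb{N}\to(0,\infty)$ be a decreasing function with $\psi(n)\to0$ as $n\to\infty$, and let $\alpha=\liminf_{n\to\infty}\frac{-\log\psi(n)}{n}\in[0,\infty]$. Then, for every value $\alpha\ge0$, $$\dim_{\rm H}R(\psi)=\frac{d\log\lambda}{\alpha+\log\lambda}.$$
   Context: $\mathbb{T}^d=\mathbb{R}^d/\mathbb{Z}^d$ is the $d$-dimensional torus with the usual quotient distance, and $B(x,r)$ is the ball with centre $x$ and radius $r$ in this distance. The recurrence set is $R(\psi)=\{x\in\mathbb{T}^d : T^n x\in B(x,\psi(n))\text{ for infinitely many }n\ge1\}$. $\dim_{\rm H}$ denotes Hausdorff dimension. When $\alpha=\infty$, the right-hand side is interpreted as $0$. *)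

theory Defs
  imports "HOL-Analysis.Analysis"
begin

section \<open>The torus $\mathbb{R}^d/\mathbb{Z}^d$\<close>

definition integer_lattice :: "(real^'n) set" where
  "integer_lattice = {k. \<forall>i. k $ i \<in> \<int>}"

lemma integer_lattice_0 [simp]: "0 \<in> integer_lattice"
  by (simp add: integer_lattice_def)

lemma integer_lattice_minus: "x \<in> integer_lattice \<Longrightarrow> - x \<in> integer_lattice"
  by (simp add: integer_lattice_def)

lemma integer_lattice_add:
  "x \<in> integer_lattice \<Longrightarrow> y \<in> integer_lattice \<Longrightarrow> x + y \<in> integer_lattice"
  by (simp add: integer_lattice_def)

lemma closed_integer_lattice: "closed (integer_lattice :: (real^'n) set)"
proof -
  have "closed ((\<lambda>v :: real^'n. v $ i) -` \<int>)" for i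
    by (intro closed_vimage closed_Ints continuous_intros)
  then have "closed (\<Inter>i. (\<lambda>v :: real^'n. v $ i) -` \<int>)" by blast
  moreover have "(\<Inter>i. (\<lambda>v :: real^'n. v $ i) -` \<int>) = integer_lattice"
    by (auto simp: integer_lattice_def)
  ultimately show ?thesis by simp
qed

definition torus_rel :: "real^'n \<Rightarrow> real^'n \<Rightarrow> bool" where
  "torus_rel x y \<longleftrightarrow> x - y \<in> integer_lattice"

quotient_type 'n torus = "(real, 'n::finite) vec" / torus_rel
proof (rule equivpI)
  show "reflp torus_rel" by (auto simp: reflp_def torus_rel_def)
  show "symp torus_rel"
    by (rule sympI, unfold torus_rel_def, drule integer_lattice_minus) simp
  show "transp torus_rel"
    by (rule transpI, unfold torus_rel_def, drule (1) integer_lattice_add) simp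
qed

lemma abs_torus_eq_iff: "abs_torus x = abs_torus y \<longleftrightarrow> x - y \<in> integer_lattice"
  by (simp add: torus.abs_eq_iff torus_rel_def)

lemma abs_torus_surj: "\<exists>x. p = abs_torus x"
  by (metis Quotient_torus Quotient_abs_rep)

instantiation torus :: (finite) metric_space
begin

text \<open>The quotient distance: the Euclidean distance between the two cosets.\<close>
definition dist_torus :: "'a torus \<Rightarrow> 'a torus \<Rightarrow> real" where
  "dist_torus p q = Inf {dist x y | x y. abs_torus x = p \<and> abs_torus y = q}"

definition uniformity_torus :: "('a torus \<times> 'a torus) filter" where
  "uniformity_torus = (INF e\<in>{0<..}. principal {(x, y). dist x y < e})"

definition open_torus :: "'a torus set \<Rightarrow> bool" where
  "open_torus U \<longleftrightarrow> (\<forall>x\<in>U. \<forall>\<^sub>F (x', y) in uniformity. x' = x \<longrightarrow> y \<in> U)"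

lemma dist_torus_le:
  fixes x y :: "real^'a"
  shows "dist (abs_torus x) (abs_torus y) \<le> dist x y"
  unfolding dist_torus_def
  by (rule cInf_lower) (auto intro!: bdd_belowI[where m = 0])

lemma dist_torus_less:
  fixes p q :: "'a torus"
  assumes "dist p q < e"
  obtains x y where "abs_torus x = p" "abs_torus y = q" "dist x y < e"
proof -
  have "{dist x y | x y. abs_torus x = p \<and> abs_torus y = q} \<noteq> {}"
    using abs_torus_surj[of p] abs_torus_surj[of q] by auto
  from cInf_lessD[OF this] assms that show ?thesis
    by (auto simp: dist_torus_def)
qed

lemma dist_torus_triangle:
  fixes p q r :: "'a torus"
  shows "dist p q \<le> dist p r + dist q r"
proof (rule field_le_epsilon)
  fix e :: real assume "0 < e"
  obtain x z where xz: "abs_torus x = p" "abs_torus z = r" "dist x z < dist p r + e / 2"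
    using dist_torus_less[of p r "dist p r + e / 2"] \<open>0 < e\<close> by auto
  obtain y z' where yz: "abs_torus y = q" "abs_torus z' = r" "dist y z' < dist q r + e / 2"
    using dist_torus_less[of q r "dist q r + e / 2"] \<open>0 < e\<close> by auto
  have "z - z' \<in> integer_lattice"
    using xz yz abs_torus_eq_iff by metis
  then have "abs_torus (y + (z - z')) = q"
    using yz(1) abs_torus_eq_iff[of "y + (z - z')" y] by simp
  then have "dist p q \<le> dist x (y + (z - z'))"
    using dist_torus_le xz(1) by metis
  also have "\<dots> \<le> dist x z + dist y z'"
  proof -
    have "x - (y + (z - z')) = (x - z) - (y - z')" by simp
    then show ?thesis by (metis dist_norm norm_triangle_ineq4)
  qed
  finally show "dist p q \<le> dist p r + dist q r + e" using xz yz by simp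
qed

lemma dist_torus_eq_0:
  fixes p q :: "'a torus"
  shows "dist p q = 0 \<longleftrightarrow> p = q"
proof
  assume pq: "dist p q = 0"
  obtain a b where ab: "p = abs_torus a" "q = abs_torus b"
    using abs_torus_surj by metis
  have "a - b \<in> closure integer_lattice"
    unfolding closure_approachable
  proof (intro allI impI)
    fix e :: real assume "0 < e"
    then obtain x y where xy: "abs_torus x = p" "abs_torus y = q" "dist x y < e"
      using dist_torus_less[of p q e] pq by auto
    have "a - x \<in> integer_lattice" "y - b \<in> integer_lattice"
      using xy ab abs_torus_eq_iff by metis+
    then have "(a - x) + (y - b) \<in> integer_lattice" by (rule integer_lattice_add)
    moreover have "dist ((a - x) + (y - b)) (a - b) = dist x y"
    proof -
      have "((a - x) + (y - b)) - (a - b) = y - x" by simp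
      then show ?thesis by (metis dist_norm dist_commute)
    qed
    ultimately show "\<exists>k\<in>integer_lattice. dist k (a - b) < e" using xy by metis
  qed
  then have "a - b \<in> integer_lattice"
    by (simp add: closure_closed[OF closed_integer_lattice])
  then show "p = q" using ab abs_torus_eq_iff by metis
next
  assume "p = q"
  moreover obtain a where "p = abs_torus a" using abs_torus_surj by metis
  moreover have "0 \<le> dist p q"
    unfolding dist_torus_def
    using abs_torus_surj[of p] abs_torus_surj[of q] by (intro cInf_greatest) auto
  ultimately show "dist p q = 0" using dist_torus_le[of a a] by simp
qed

instance
proof
  show "uniformity = (INF e\<in>{0<..}. principal {(x, y :: 'a torus). dist x y < e})"
    by (rule uniformity_torus_def)
  show "open U \<longleftrightarrow> (\<forall>x\<in>U. \<forall>\<^sub>F (x', y) in uniformity. x' = x \<longrightarrow> y \<in> U)" for U :: "'a torus set"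
    by (rule open_torus_def)
  show "dist p q = 0 \<longleftrightarrow> p = q" for p q :: "'a torus"
    by (rule dist_torus_eq_0)
  show "dist p q \<le> dist p r + dist q r" for p q r :: "'a torus"
    by (rule dist_torus_triangle)
qed

end

lift_definition torus_map :: "int^'n^'n \<Rightarrow> 'n torus \<Rightarrow> 'n torus"
  is "\<lambda>A x. map_matrix of_int A *v x"
proof -
  fix A :: "int^'n^'n" and x y :: "real^'n"
  assume "torus_rel x y"
  then have "x - y \<in> integer_lattice" by (simp add: torus_rel_def)
  then have "map_matrix of_int A *v (x - y) \<in> integer_lattice"
    by (auto simp: integer_lattice_def matrix_vector_mult_def intro!: Ints_sum Ints_mult)
  then show "torus_rel (map_matrix of_int A *v x) (map_matrix of_int A *v y)"
    by (simp add: torus_rel_def matrix_vector_mult_diff_distrib)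
qed

definition complex_eigenvalue :: "int^'n^'n \<Rightarrow> complex \<Rightarrow> bool" where
  "complex_eigenvalue A c \<longleftrightarrow> (\<exists>v. v \<noteq> 0 \<and> map_matrix of_int A *v v = c *s v)"


section \<open>Hausdorff dimension\<close>

text \<open>
  The term $|U|^s$ of the Hausdorff sums, with $|\emptyset|^s = 0$ for all $s \ge 0$ and
  $|U|^0 = 1$ for all nonempty $U$ (note that \<^term>\<open>0 powr 0 = (0::real)\<close>).
\<close>
definition diameter_powr :: "real \<Rightarrow> 'a::metric_space set \<Rightarrow> real" where
  "diameter_powr s U = (if U = {} then 0 else if s = 0 then 1 else diameter U powr s)"

text \<open>
  The sets of a cover are required to be bounded because \<^const>\<open>diameter\<close> is
  only meaningful for bounded sets.
\<close>
definition hausdorff_premeasure :: "real \<Rightarrow> real \<Rightarrow> 'a::metric_space set \<Rightarrow> ennreal" where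
  "hausdorff_premeasure s \<delta> E =
     (INF U \<in> {U :: nat \<Rightarrow> 'a set. E \<subseteq> (\<Union>i. U i) \<and> (\<forall>i. bounded (U i) \<and> diameter (U i) \<le> \<delta>)}.
        \<Sum>i. ennreal (diameter_powr s (U i)))"

definition hausdorff_measure :: "real \<Rightarrow> 'a::metric_space set \<Rightarrow> ennreal" where
  "hausdorff_measure s E = (SUP \<delta>\<in>{0<..}. hausdorff_premeasure s \<delta> E)"

definition hausdorff_dim :: "'a::metric_space set \<Rightarrow> ereal" where
  "hausdorff_dim E = Inf {ereal s | s. 0 \<le> s \<and> hausdorff_measure s E = 0}"


section \<open>Recurrence sets\<close>

definition recurrence_set :: "('a::metric_space \<Rightarrow> 'a) \<Rightarrow> (nat \<Rightarrow> real) \<Rightarrow> 'a set" where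
  "recurrence_set T \<psi> = {x. infinite {n. 1 \<le> n \<and> (T ^^ n) x \<in> ball x (\<psi> n)}}"

end

theory Submission
  imports Defs "HOL-Computational_Algebra.Fundamental_Theorem_Algebra" "HOL-Real_Asymp.Real_Asymp"
begin

text \<open>
  Write L = log \<lambda> and d for the dimension of the torus. Because all eigenvalues have modulus \<lambda>, the
  map A^n - I expands every vector by a factor e^(nL) up to subexponential errors
  (\<open>displacement_bounds\<close>). The points x with T^n x within \<psi>(n) of x therefore form, around each of
  the roughly e^(dnL) points of period n, a set of diameter about e^(-nL) \<psi>(n), and the recurrence
  set is the limsup of these unions.

  Upper bound. Using these sets themselves as a cover gives the sum of
  e^(dnL) (e^(-nL) \<psi>(n))^s over n, which converges once s (\<alpha> + L) > dL
  (\<open>hausdorff_measure_recurrence_set_eq_0\<close>). The number of sets is estimated by counting the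
  integer vectors k that lie near A^n x - x for some x in a fixed ball.

  Lower bound. The points of period n are e^(-nL)-dense, so the limsup set has the structure to which
  the mass transference principle applies: balls of radius r = e^(-nL) around these points cover
  everything, and the limsup set retains the shrunken balls of radius \<rho> = e^(-nL) \<psi>(n), where
  \<rho>^s is much larger than r^d for infinitely many n as soon as s (\<alpha> + L) < dL. Instead of
  constructing a measure, the proof attacks a given cover directly. Suppose sets U_i of diameter at
  most D_i cover the recurrence set and the sum of D_i^s is tiny. One selects a nested sequence of
  balls around periodic points such that the sets U_i meeting a ball of radius \<rho> always have
  total weight (sum of D_i^s) at most c \<rho>^s with a fixed c < 1. If such a ball is given, many
  disjoint candidates for the next ball lie in it on a grid, each U_i meets only few of them, and by
  averaging one of them satisfies the same bound (\<open>ex_child_ball\<close>). The limit point is recurrent.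
  It lies in no U_i, since a U_i containing it would meet all the balls and hence have D_i = 0
  (\<open>limsup_escapes_cover\<close>).
\<close>

section \<open>Exponential growth of the powers of an integer matrix\<close>

text \<open>
  The action of p(f) on a single vector, so that no ring of endomorphisms is needed.
\<close>
definition poly_action :: "('a::field^'n \<Rightarrow> 'a^'n) \<Rightarrow> 'a poly \<Rightarrow> 'a^'n \<Rightarrow> 'a^'n" where
  "poly_action f p v = (\<Sum>i\<le>degree p. coeff p i *s (f ^^ i) v)"

lemma poly_action_sum:
  assumes "degree p \<le> N"
  shows "poly_action f p v = (\<Sum>i\<le>N. coeff p i *s (f ^^ i) v)"
  unfolding poly_action_def
  by (rule sum.mono_neutral_left) (use assms in \<open>auto simp: coeff_eq_0\<close>)

lemma poly_action_pCons: "poly_action f (pCons a p) v = a *s v + poly_action f p (f v)"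
proof -
  have "poly_action f (pCons a p) v = (\<Sum>i\<le>Suc (degree p). coeff (pCons a p) i *s (f ^^ i) v)"
    by (intro poly_action_sum) (simp add: degree_pCons_le)
  also have "\<dots> = a *s v + poly_action f p (f v)"
    by (subst sum.atMost_Suc_shift) (simp add: poly_action_def funpow_swap1)
  finally show ?thesis .
qed

lemma poly_action_commute:
  assumes "Vector_Spaces.linear (*s) (*s) f"
  shows "poly_action f p (f v) = f (poly_action f p v)"
proof -
  interpret Vector_Spaces.linear "(*s)" "(*s)" f by fact
  show ?thesis by (simp add: poly_action_def sum scale funpow_swap1)
qed

lemma poly_action_linear_factor:
  assumes "Vector_Spaces.linear (*s) (*s) f"
  shows "poly_action f ([:-c, 1:] * q) v = poly_action f q (f v - c *s v)"
    and "poly_action f ([:-c, 1:] * q) v = f (poly_action f q v) - c *s poly_action f q v"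
proof -
  interpret Vector_Spaces.linear "(*s)" "(*s)" f by fact
  have lin: "(f ^^ i) (f v - c *s v) = (f ^^ i) (f v) - c *s (f ^^ i) v" for i
    by (induction i) (simp_all add: diff scale)
  have "degree ([:-c, 1:] * q) \<le> Suc (degree q)"
    using degree_mult_le[of "[:-c, 1:]" q] by simp
  then have "poly_action f ([:-c, 1:] * q) v
     = (\<Sum>i\<le>Suc (degree q). coeff (pCons 0 q) i *s (f ^^ i) v)
       - (\<Sum>i\<le>Suc (degree q). (c * coeff q i) *s (f ^^ i) v)"
    by (simp add: poly_action_sum algebra_simps coeff_diff sum_subtractf vector_sub_rdistrib del: sum.atMost_Suc)
  also have "(\<Sum>i\<le>Suc (degree q). coeff (pCons 0 q) i *s (f ^^ i) v) = poly_action f (pCons 0 q) v"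
    by (rule poly_action_sum[symmetric]) (simp add: degree_pCons_le)
  also have "(\<Sum>i\<le>Suc (degree q). (c * coeff q i) *s (f ^^ i) v) = c *s poly_action f q v"
    by (simp add: poly_action_def vec.scale_sum_right coeff_eq_0)
  finally have *: "poly_action f ([:-c, 1:] * q) v = poly_action f q (f v) - c *s poly_action f q v"
    by (simp add: poly_action_pCons)
  then show "poly_action f ([:-c, 1:] * q) v = f (poly_action f q v) - c *s poly_action f q v"
    by (simp add: poly_action_commute[OF assms])
  show "poly_action f ([:-c, 1:] * q) v = poly_action f q (f v - c *s v)"
    unfolding * by (simp add: poly_action_def lin vec.scale_right_diff_distrib sum_subtractf
       vec.scale_sum_right mult.commute)
qed

lemma ex_annihilating_poly:
  fixes f :: "'a::field^'n \<Rightarrow> 'a^'n"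
  shows "\<exists>p. p \<noteq> 0 \<and> poly_action f p v = 0"
proof -
  define d where "d = vec.dim (UNIV :: ('a^'n) set)"
  define g where "g i = (f ^^ i) v" for i
  show ?thesis
  proof (cases "inj_on g {..d}")
    case True
    have "vec.dependent (g ` {..d})"
    proof (rule ccontr)
      assume "vec.independent (g ` {..d})"
      then have "card (g ` {..d}) \<le> d"
        unfolding d_def by (intro vec.independent_card_le_dim) auto
      then show False by (simp add: card_image[OF True])
    qed
    then obtain u i where u: "i \<le> d" "u (g i) \<noteq> 0" "(\<Sum>w\<in>g ` {..d}. u w *s w) = 0"
      by (auto simp: vec.dependent_finite)
    define p where "p = (\<Sum>i\<le>d. monom (u (g i)) i)"
    have cf: "coeff p i = (if i \<le> d then u (g i) else 0)" for i
      by (simp add: p_def coeff_sum)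
    have "p \<noteq> 0" using cf[of i] u by auto
    moreover have "degree p \<le> d" by (rule degree_le) (simp add: cf)
    then have "poly_action f p v = (\<Sum>i\<le>d. u (g i) *s g i)"
      by (simp add: poly_action_sum cf g_def)
    then have "poly_action f p v = 0"
      using u(3) by (simp add: sum.reindex[OF True])
    ultimately show ?thesis by blast
  next
    case False
    then obtain i j where ij: "i \<noteq> j" "g i = g j" by (auto simp: inj_on_def)
    define p where "p = monom (1::'a) i - monom 1 j"
    have "coeff p i = 1" using ij by (simp add: p_def)
    then have "p \<noteq> 0" by auto
    moreover have "degree p \<le> i + j"
      by (rule degree_le) (auto simp: p_def)
    then have "poly_action f p v = (\<Sum>k\<le>i+j. (if k = i then g i else 0) - (if k = j then g j else 0))"
      unfolding poly_action_sum[OF \<open>degree p \<le> i + j\<close>]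
      by (intro sum.cong) (auto simp: p_def g_def)
    then have "poly_action f p v = 0"
      using ij by (simp add: sum_subtractf)
    ultimately show ?thesis by blast
  qed
qed

lemma norm_vector_scalar_mult: "norm (c *s v) = norm c * norm (v :: complex^'n)"
  by (simp add: norm_vec_def L2_set_def norm_mult power_mult_distrib sum_distrib_left[symmetric] real_sqrt_mult)

text \<open>
  Solving the recursion v_(n+1) = c v_n + u_n for v_n = f^n v and u_n = f^n (f v - c v) by variation of
  constants: since \<mu> exceeds the modulus of c, the geometric sum is again of order \<mu>^n. Each linear
  factor of an annihilating polynomial is peeled off in this way.
\<close>
lemma bound_from_shifted_bound:
  fixes f :: "complex^'n \<Rightarrow> complex^'n"
  assumes lin: "Vector_Spaces.linear (*s) (*s) f" and c: "cmod c \<le> r" "r < \<mu>"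
    and C: "\<And>n. norm ((f ^^ n) (f v - c *s v)) \<le> C * \<mu> ^ n"
  shows "norm ((f ^^ n) v) \<le> (norm v + C / (\<mu> - r)) * \<mu> ^ n"
proof -
  interpret Vector_Spaces.linear "(*s)" "(*s)" f by fact
  have r: "0 \<le> r" "0 < \<mu>" using c norm_ge_zero[of c] by linarith+
  have shift: "(f ^^ n) (f v - c *s v) = (f ^^ Suc n) v - c *s (f ^^ n) v" for n
    by (induction n) (simp_all add: diff scale)
  have C0: "0 \<le> C" using order_trans[OF norm_ge_zero C[of 0]] by simp
  have "norm ((f ^^ n) v) \<le> norm v * r ^ n + C * (\<mu> ^ n - r ^ n) / (\<mu> - r)"
  proof (induction n)
    case (Suc n)
    have "(f ^^ Suc n) v = c *s (f ^^ n) v + (f ^^ n) (f v - c *s v)" by (simp only: shift) simp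
    then have "norm ((f ^^ Suc n) v) \<le> cmod c * norm ((f ^^ n) v) + C * \<mu> ^ n"
      by (metis C norm_triangle_mono norm_vector_scalar_mult order_refl)
    also have "\<dots> \<le> r * (norm v * r ^ n + C * (\<mu> ^ n - r ^ n) / (\<mu> - r)) + C * \<mu> ^ n"
      using Suc c r by (intro add_right_mono mult_mono) auto
    also have "\<dots> = norm v * r ^ Suc n + C * (\<mu> ^ Suc n - r ^ Suc n) / (\<mu> - r)"
      using c by (simp add: field_simps)
    finally show ?case .
  qed auto
  also have "\<dots> \<le> norm v * \<mu> ^ n + C * \<mu> ^ n / (\<mu> - r)"
    using c r C0 by (intro add_mono mult_left_mono power_mono divide_right_mono) auto
  finally show ?thesis by (simp add: algebra_simps)
qed

text \<open>
  Induction on the degree of an annihilating polynomial of v. A root c of modulus at most r is removed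
  by passing to f v - c v. A larger root is no eigenvalue, so f - c is injective and the cofactor
  already annihilates v.
\<close>
lemma orbit_growth_if_annihilated:
  fixes f :: "complex^'n \<Rightarrow> complex^'n"
  assumes lin: "Vector_Spaces.linear (*s) (*s) f"
    and eig: "\<And>c v. v \<noteq> 0 \<Longrightarrow> f v = c *s v \<Longrightarrow> cmod c \<le> r" and "r < \<mu>"
    and "p \<noteq> 0" "poly_action f p v = 0"
  shows "\<exists>C. \<forall>n. norm ((f ^^ n) v) \<le> C * \<mu> ^ n"
  using \<open>p \<noteq> 0\<close> \<open>poly_action f p v = 0\<close>
proof (induction "degree p" arbitrary: p v)
  case 0
  interpret Vector_Spaces.linear "(*s)" "(*s)" f by fact
  obtain a where "p = [:a:]" using 0 by (metis degree_eq_zeroE)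
  then have "v = 0" using 0 by (simp add: poly_action_def)
  moreover have "(f ^^ n) 0 = 0" for n by (induction n) (auto simp: zero)
  ultimately show ?case by (intro exI[of _ 0]) auto
next
  case (Suc m)
  obtain c where "poly p c = 0"
    using fundamental_theorem_of_algebra[of p] Suc.hyps(2) constant_degree[of p] by auto
  then obtain q where q: "p = [:-c, 1:] * q" using poly_eq_0_iff_dvd by (metis dvdE)
  then have q0: "q \<noteq> 0" using Suc.prems by auto
  have "degree p = degree [:-c, 1:] + degree q"
    unfolding q using q0 by (intro degree_mult_eq) auto
  then have deg: "m = degree q" using Suc.hyps(2) by simp
  show ?case
  proof (cases "cmod c \<le> r")
    case True
    have "poly_action f q (f v - c *s v) = 0"
      using Suc.prems q poly_action_linear_factor(1)[OF lin] by metis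
    then obtain C where "\<forall>n. norm ((f ^^ n) (f v - c *s v)) \<le> C * \<mu> ^ n"
      using Suc.hyps(1)[OF deg q0] by blast
    then show ?thesis
      using bound_from_shifted_bound[OF lin True \<open>r < \<mu>\<close>] by blast
  next
    case False
    have "f (poly_action f q v) = c *s poly_action f q v"
      using Suc.prems q poly_action_linear_factor(2)[OF lin] by (metis eq_iff_diff_eq_0)
    then have "poly_action f q v = 0" using eig False by blast
    then show ?thesis using Suc.hyps(1)[OF deg q0] by blast
  qed
qed

text \<open>
  The part of Gelfand's spectral radius formula that is used, obtained from the orbits of the standard
  basis.
\<close>
lemma power_norm_bound:
  fixes f :: "complex^'n \<Rightarrow> complex^'n"
  assumes lin: "Vector_Spaces.linear (*s) (*s) f"
    and eig: "\<And>c v. v \<noteq> 0 \<Longrightarrow> f v = c *s v \<Longrightarrow> cmod c \<le> r" and "r < \<mu>" "0 < \<mu>"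
  shows "\<exists>C>0. \<forall>n v. norm ((f ^^ n) v) \<le> C * \<mu> ^ n * norm v"
proof -
  interpret Vector_Spaces.linear "(*s)" "(*s)" f by fact
  have "\<exists>C. \<forall>n. norm ((f ^^ n) (axis i 1)) \<le> C * \<mu> ^ n" for i
  proof -
    obtain p where p: "p \<noteq> 0" "poly_action f p (axis i 1) = 0"
      using ex_annihilating_poly by blast
    show ?thesis by (rule orbit_growth_if_annihilated[OF lin _ \<open>r < \<mu>\<close> p]) (rule eig)
  qed
  then obtain C where C: "\<And>i n. norm ((f ^^ n) (axis i 1)) \<le> C i * \<mu> ^ n" by metis
  have C0: "0 \<le> C i" for i using order_trans[OF norm_ge_zero C[where n = 0 and i = i]] by simp
  have lin: "(f ^^ n) (\<Sum>i\<in>UNIV. v $ i *s axis i 1) = (\<Sum>i\<in>UNIV. v $ i *s (f ^^ n) (axis i 1))" for n and v :: "complex^'n"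
    by (induction n) (simp_all add: sum scale)
  have "norm ((f ^^ n) v) \<le> (sum C UNIV + 1) * \<mu> ^ n * norm v" if "\<mu> > 0" for n v
  proof -
    have "norm ((f ^^ n) v) = norm (\<Sum>i\<in>UNIV. v $ i *s (f ^^ n) (axis i 1))"
      using lin[of n v] by (simp add: basis_expansion)
    also have "\<dots> \<le> (\<Sum>i\<in>UNIV. norm (v $ i *s (f ^^ n) (axis i 1)))" by (rule norm_sum)
    also have "\<dots> \<le> (\<Sum>i\<in>UNIV. norm v * (C i * \<mu> ^ n))"
      unfolding norm_vector_scalar_mult by (intro sum_mono mult_mono C Finite_Cartesian_Product.norm_nth_le) auto
    also have "\<dots> = sum C UNIV * \<mu> ^ n * norm v" by (simp add: sum_distrib_left sum_distrib_right algebra_simps)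
    also have "\<dots> \<le> (sum C UNIV + 1) * \<mu> ^ n * norm v"
      using that by (intro mult_right_mono) auto
    finally show ?thesis .
  qed
  moreover note \<open>0 < \<mu>\<close>
  moreover have "sum C UNIV + 1 > 0" using C0 by (simp add: sum_nonneg add_nonneg_pos)
  ultimately show ?thesis by blast
qed

definition complex_vec :: "real^'n \<Rightarrow> complex^'n" where
  "complex_vec v = (\<chi> i. complex_of_real (v $ i))"

lemma norm_complex_vec: "norm (complex_vec v) = norm v"
  by (simp add: complex_vec_def norm_vec_def)

lemma complex_vec_matrix:
  fixes A :: "int^'n^'n"
  shows "map_matrix of_int A *v complex_vec v = complex_vec (map_matrix of_int A *v v)"
  by (simp add: complex_vec_def matrix_vector_mult_def vec_eq_iff map_matrix_def)

text \<open>
  The lower estimate is the upper one for the inverse matrix, whose eigenvalues have modulus 1 / lam.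
\<close>
lemma integer_matrix_growth:
  fixes A :: "int^'n^'n"
  defines "f \<equiv> (*v) (map_matrix of_int A :: real^'n^'n)"
  assumes eig: "\<And>c. complex_eigenvalue A c \<Longrightarrow> cmod c = lam" and "0 < lam"
    and ab: "b < ln lam" "ln lam < a"
  shows "\<exists>C\<ge>1. \<forall>n v. norm ((f ^^ n) v) \<le> C * exp (a * real n) * norm v
      \<and> exp (b * real n) * norm v \<le> C * norm ((f ^^ n) v)"
proof -
  define F where "F = (*v) (map_matrix of_int A :: complex^'n^'n)"
  have linF: "Vector_Spaces.linear (*s) (*s) F" unfolding F_def by simp
  have eigF: "cmod c = lam" if "v \<noteq> 0" "F v = c *s v" for c v
    using that eig unfolding F_def complex_eigenvalue_def by blast
  have exp_n: "exp a ^ n = exp (a * real n)" for a :: real and n by (metis exp_of_nat_mult mult.commute)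
  have "\<exists>C>0. \<forall>n v. norm ((F ^^ n) v) \<le> C * exp a ^ n * norm v"
  proof (rule power_norm_bound[OF linF, where r = lam])
    show "lam < exp a" using ab \<open>0 < lam\<close> by (metis exp_less_mono exp_ln)
  qed (use eigF in auto)
  then obtain C1 where C1: "C1 > 0" "\<And>n v. norm ((F ^^ n) v) \<le> C1 * exp (a * real n) * norm v"
    unfolding exp_n by blast
  have "inj F"
  proof -
    interpret Vector_Spaces.linear "(*s)" "(*s)" F by (rule linF)
    have "v = 0" if "F v = 0" for v
      using eigF[of v 0] that \<open>0 < lam\<close> by auto
    then show ?thesis using inj_iff_eq_0 by blast
  qed
  then obtain g where g: "Vector_Spaces.linear (*s) (*s) g" "g \<circ> F = id"
    using vec.linear_injective_left_inverse[OF linF] by blast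
  then have Fg: "F \<circ> g = id" using vec.linear_inverse_left linF by blast
  have eigg: "cmod c \<le> 1 / lam" if v: "v \<noteq> 0" "g v = c *s v" for c v
  proof -
    interpret Vector_Spaces.linear "(*s)" "(*s)" F by (rule linF)
    have "v = c *s F v" using Fg v by (metis comp_apply id_apply scale)
    then have "c \<noteq> 0" "F v = (1 / c) *s v" using v by (auto simp: vec_eq_iff)
    then have "cmod (1 / c) = lam" using eigF v by blast
    then show ?thesis using \<open>0 < lam\<close> by (auto simp: norm_divide field_simps)
  qed
  have "\<exists>C>0. \<forall>n v. norm ((g ^^ n) v) \<le> C * exp (- b) ^ n * norm v"
  proof (rule power_norm_bound[OF g(1), where r = "1 / lam"])
    have "exp b < lam" using ab \<open>0 < lam\<close> by (metis exp_less_mono exp_ln)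
    then show "1 / lam < exp (- b)" using \<open>0 < lam\<close> by (simp add: exp_minus field_simps)
  qed (use eigg in auto)
  then obtain C2 where C2: "C2 > 0" "\<And>n v. norm ((g ^^ n) v) \<le> C2 * exp (- b * real n) * norm v"
    unfolding exp_n by blast
  have gF1: "g (F v) = v" for v using g(2) by (metis comp_apply id_apply)
  have gF: "(g ^^ n) ((F ^^ n) v) = v" for n v
  proof (induction n)
    case (Suc n)
    have "(g ^^ Suc n) ((F ^^ Suc n) v) = (g ^^ n) (g (F ((F ^^ n) v)))"
      unfolding funpow_Suc_right[of n g] by simp
    then show ?case using Suc by (simp only: gF1)
  qed simp
  have cv: "(F ^^ n) (complex_vec v) = complex_vec ((f ^^ n) v)" for n v
    by (induction n) (simp_all add: F_def f_def complex_vec_matrix)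
  have up: "norm ((f ^^ n) v) \<le> C1 * exp (a * real n) * norm v" for n v
    using C1(2)[of n "complex_vec v"] by (simp add: cv norm_complex_vec)
  have low: "exp (b * real n) * norm v \<le> C2 * norm ((f ^^ n) v)" for n v
    using C2(2)[of n "(F ^^ n) (complex_vec v)", unfolded gF]
    by (simp add: cv norm_complex_vec exp_minus field_simps)
  show ?thesis
  proof (intro exI[of _ "max 1 (max C1 C2)"] conjI allI)
    fix n v
    show "norm ((f ^^ n) v) \<le> max 1 (max C1 C2) * exp (a * real n) * norm v"
      by (rule order_trans[OF up]) (intro mult_right_mono, auto)
    show "exp (b * real n) * norm v \<le> max 1 (max C1 C2) * norm ((f ^^ n) v)"
      by (rule order_trans[OF low]) (intro mult_right_mono, auto)
  qed simp
qed

section \<open>Limsup sets of small balls escape efficient covers\<close>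

definition real_vec :: "int^'n \<Rightarrow> real^'n" where
  "real_vec k = (\<chi> i. real_of_int (k $ i))"

lemma int_box:
  fixes S :: "'n::finite \<Rightarrow> int set"
  assumes "\<And>i. finite (S i)"
  shows finite_int_box: "finite {k :: int^'n. \<forall>i. k $ i \<in> S i}"
    and card_int_box: "card {k :: int^'n. \<forall>i. k $ i \<in> S i} = (\<Prod>i\<in>UNIV. card (S i))"
proof -
  have "bij_betw vec_lambda (PiE UNIV S) {k :: int^'n. \<forall>i. k $ i \<in> S i}"
    by (rule bij_betw_byWitness[where f' = vec_nth]) (auto simp: vec_eq_iff)
  then show "finite {k :: int^'n. \<forall>i. k $ i \<in> S i}" "card {k :: int^'n. \<forall>i. k $ i \<in> S i} = (\<Prod>i\<in>UNIV. card (S i))"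
    using bij_betw_finite bij_betw_same_card finite_PiE[of UNIV S] card_PiE[of UNIV S] assms
    by fastforce+
qed

lemma int_cube:
  fixes a :: "int^'n" and m :: int
  assumes "m \<ge> 0"
  shows finite_int_cube: "finite {k :: int^'n. \<forall>i. \<bar>k $ i - a $ i\<bar> \<le> m}"
    and card_int_cube: "card {k :: int^'n. \<forall>i. \<bar>k $ i - a $ i\<bar> \<le> m} = nat (2 * m + 1) ^ CARD('n)"
proof -
  have eq: "{k :: int^'n. \<forall>i. \<bar>k $ i - a $ i\<bar> \<le> m} = {k. \<forall>i. k $ i \<in> {a $ i - m..a $ i + m}}"
    by (auto simp: abs_le_iff algebra_simps)
  show "finite {k :: int^'n. \<forall>i. \<bar>k $ i - a $ i\<bar> \<le> m}"
    unfolding eq by (rule finite_int_box) simp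
  show "card {k :: int^'n. \<forall>i. \<bar>k $ i - a $ i\<bar> \<le> m} = nat (2 * m + 1) ^ CARD('n)"
    unfolding eq by (subst card_int_box) (auto simp: algebra_simps)
qed

text \<open>
  The inequality that makes the averaging work. Here \<delta> is the grid spacing inside a ball of radius
  \<rho> and \<rho>' the radius of the new balls. A set of diameter D meets a proportion of at most
  C (max \<delta> D / \<rho>)^d of them, and its weight is truncated at \<rho>'^s. If D \<le> \<delta>, the claim is the
  assumption that \<rho>'^s dominates \<delta>^d. If D > \<delta>, then D / \<rho> is at most c^(1/s), and the factor
  (D / \<rho>)^(d - s) gained from s < d absorbs C; this is what keeps c from deteriorating from one
  generation to the next.
\<close>
lemma child_weight_le:
  fixes s c \<rho> \<rho>' \<delta> D :: real and d :: nat
  assumes "0 < s" "s < d" "0 < c" "C * c powr ((d - s) / s) \<le> 1" "C \<ge> 0"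
    and "0 < \<rho>'" "0 < \<rho>" "0 < \<delta>" "0 < D"
    and K: "C * \<delta> ^ d * \<rho> powr s \<le> \<rho>' powr s * \<rho> ^ d"
    and D: "D powr s \<le> c * \<rho> powr s"
  shows "C * max \<delta> D ^ d * min (D powr s) (\<rho>' powr s) * \<rho> powr s \<le> D powr s * \<rho>' powr s * \<rho> ^ d"
proof (cases "D \<le> \<delta>")
  case True
  have "C * max \<delta> D ^ d * min (D powr s) (\<rho>' powr s) * \<rho> powr s
      \<le> C * max \<delta> D ^ d * D powr s * \<rho> powr s"
    using assms by (intro mult_right_mono mult_left_mono) auto
  also have "\<dots> = D powr s * (C * \<delta> ^ d * \<rho> powr s)"
    using True by (simp add: max_def)
  also have "\<dots> \<le> D powr s * (\<rho>' powr s * \<rho> ^ d)" using K by (intro mult_left_mono) auto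
  finally show ?thesis by (simp add: mult.assoc)
next
  case False
  have "(D / \<rho>) powr s \<le> c" using D assms by (simp add: powr_divide field_simps)
  then have "((D / \<rho>) powr s) powr ((d - s) / s) \<le> c powr ((d - s) / s)"
    using assms by (intro powr_mono2) auto
  then have "(D / \<rho>) powr (d - s) \<le> c powr ((d - s) / s)"
    using assms by (simp add: powr_powr)
  then have "C * (D / \<rho>) powr (d - s) \<le> 1"
    using assms(4) \<open>C \<ge> 0\<close> by (meson mult_left_mono order_trans)
  then have "C * D ^ d * \<rho> powr s \<le> D powr s * \<rho> ^ d"
    using assms by (simp add: powr_divide powr_diff powr_realpow field_simps)
  then have *: "\<rho>' powr s * (C * D ^ d * \<rho> powr s) \<le> \<rho>' powr s * (D powr s * \<rho> ^ d)"
    by (intro mult_left_mono) auto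
  have "C * max \<delta> D ^ d * min (D powr s) (\<rho>' powr s) * \<rho> powr s
      \<le> C * max \<delta> D ^ d * \<rho>' powr s * \<rho> powr s"
    using assms by (intro mult_right_mono mult_left_mono) auto
  also have "\<dots> \<le> D powr s * \<rho>' powr s * \<rho> ^ d"
    using * False by (simp add: max_def mult_ac)
  finally show ?thesis .
qed

lemma norm_real_vec_le:
  fixes k :: "int^'n"
  assumes "\<And>i. \<bar>real_of_int (k $ i)\<bar> \<le> b"
  shows "norm (real_vec k) \<le> real CARD('n) * b"
proof -
  have "norm (real_vec k) \<le> (\<Sum>i\<in>UNIV. \<bar>real_vec k $ i\<bar>)" by (rule norm_le_l1_cart)
  also have "\<dots> \<le> (\<Sum>i\<in>(UNIV::'n set). b)" using assms by (intro sum_mono) (simp add: real_vec_def)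
  finally show ?thesis by simp
qed

text \<open>
  One generation of the construction. The invariant with c < 1 rules out that a set U i with
  D i \<ge> \<rho>' meets the chosen ball, so the weights truncated at \<rho>'^s, for which the averaging is
  done, agree with the true ones there.
\<close>
lemma ex_child_ball:
  fixes p :: "real^'n" and U :: "nat \<Rightarrow> (real^'n) set" and D :: "nat \<Rightarrow> real" and c s :: real
  defines "d \<equiv> CARD('n)"
  assumes s: "0 < s" "s < real d" and c: "0 < c" "c < 1" "(10 * real d) ^ d * c powr ((d - s) / s) \<le> 1"
    and rho: "0 < \<rho>'" "\<rho>' \<le> \<delta> / 4" "\<delta> \<le> \<rho>"
    and K: "(10 * real d) ^ d * \<delta> ^ d * \<rho> powr s \<le> \<rho>' powr s * \<rho> ^ d"
    and P: "\<And>y. \<exists>q\<in>P. dist y q \<le> \<delta> / 4"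
    and U: "\<And>i x y. x \<in> U i \<Longrightarrow> y \<in> U i \<Longrightarrow> dist x y \<le> D i"
    and D: "\<And>i. 0 < D i" "summable (\<lambda>i. D i powr s)"
    and inv: "(\<Sum>i. if U i \<inter> cball p \<rho> \<noteq> {} then D i powr s else 0) \<le> c * \<rho> powr s"
  shows "\<exists>q\<in>P. cball q \<rho>' \<subseteq> cball p \<rho> \<and>
      (\<Sum>i. if U i \<inter> cball q \<rho>' \<noteq> {} then D i powr s else 0) \<le> c * \<rho>' powr s"
proof -
  have d: "d \<ge> 1" by (simp add: d_def Suc_leI)
  have pos: "0 < \<delta>" "0 < \<rho>" using rho by linarith+
  \<comment> \<open>The grid p + \<delta> k with all coordinates of k at most m in modulus stays within \<rho> / 2 of p.\<close>
  define m :: int where "m = \<lfloor>\<rho> / (2 * real d * \<delta>)\<rfloor>"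
  have m0: "m \<ge> 0" unfolding m_def using pos by simp
  define K where "K = {k :: int^'n. \<forall>i. \<bar>k $ i - 0 $ i\<bar> \<le> m}"
  define N where "N = card K"
  have N: "finite K" "N = nat (2 * m + 1) ^ d"
    unfolding N_def K_def d_def by (rule finite_int_cube[OF m0], rule card_int_cube[OF m0])
  have N0: "N > 0" using N m0 by simp
  define y where "y k = p + \<delta> *\<^sub>R real_vec k" for k :: "int^'n"
  obtain Q where Q: "\<And>y. Q y \<in> P" "\<And>y. dist y (Q y) \<le> \<delta> / 4"
    using P by metis
  define q where "q k = Q (y k)" for k
  have q: "\<And>k. q k \<in> P" "\<And>k. dist (y k) (q k) \<le> \<delta> / 4"
    using Q by (auto simp: q_def)
  \<comment> \<open>Two points in the balls of two cells are thus as far apart as the grid points, up to \<delta>.\<close>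
  have near: "dist (y k) x \<le> \<delta> / 2" if "x \<in> cball (q k) \<rho>'" for k x
    using dist_triangle[of "y k" x "q k"] q(2)[of k] that rho by (simp; linarith)
  have sub: "cball (q k) \<rho>' \<subseteq> cball p \<rho>" if "k \<in> K" for k
  proof
    fix x assume "x \<in> cball (q k) \<rho>'"
    then have "dist (y k) x \<le> \<delta> / 2" by (rule near)
    moreover have "dist p (y k) \<le> \<rho> / 2"
    proof -
      have "norm (real_vec k) \<le> real d * m"
        unfolding d_def using that by (intro norm_real_vec_le) (simp add: K_def flip: of_int_abs)
      also have "\<dots> \<le> real d * (\<rho> / (2 * real d * \<delta>))"
        unfolding m_def by (intro mult_left_mono) auto
      finally show ?thesis using pos d by (simp add: y_def dist_norm field_simps)
    qed
    ultimately show "x \<in> cball p \<rho>"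
      using dist_triangle[of p x "y k"] rho by simp
  qed
  define g where "g i = (if U i \<inter> cball p \<rho> \<noteq> {} then D i powr s else 0)" for i
  define f where "f i k = (if U i \<inter> cball (q k) \<rho>' \<noteq> {} then min (D i powr s) (\<rho>' powr s) else 0)" for i k
  have sum_g: "summable g"
    by (rule summable_comparison_test'[OF D(2), of 0]) (auto simp: g_def)
  have sum_f: "summable (\<lambda>i. f i k)" for k
    by (rule summable_comparison_test'[OF D(2), of 0]) (auto simp: f_def)
  have g_inv: "suminf g \<le> c * \<rho> powr s" using inv by (simp add: g_def[abs_def])
  have cell_sum: "(\<Sum>k\<in>K. f i k) \<le> N * \<rho>' powr s / \<rho> powr s * g i" for i
  proof (cases "U i \<inter> cball p \<rho> = {}")
    case True
    then have "f i k = 0" if "k \<in> K" for k using sub[OF that] by (auto simp: f_def)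
    then show ?thesis using True by (simp add: g_def)
  next
    case meets: False
    define M where "M = {k \<in> K. U i \<inter> cball (q k) \<rho>' \<noteq> {}}"
    define w where "w = min (D i powr s) (\<rho>' powr s)"
    have w0: "w \<ge> 0" by (simp add: w_def)
    have sum_eq: "(\<Sum>k\<in>K. f i k) = real (card M) * w"
      unfolding f_def M_def w_def using N by (simp add: sum.If_cases Int_def conj_commute)
    have "D i powr s \<le> suminf g"
      using sum_le_suminf[OF sum_g, of "{i}"] meets by (simp add: g_def)
    then have Di: "D i powr s \<le> c * \<rho> powr s" using g_inv by simp
    have card_M: "real (card M) \<le> (5 * max \<delta> (D i) / \<delta>) ^ d"
    proof (cases "M = {}")
      case False
      then obtain k where k: "k \<in> M" by auto
      define t where "t = \<lfloor>D i / \<delta> + 1\<rfloor>"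
      have t0: "t \<ge> 0" using D(1)[of i] pos by (simp add: t_def add_nonneg_nonneg order.strict_implies_order)
      have "M \<subseteq> {k'. \<forall>j. \<bar>k' $ j - k $ j\<bar> \<le> t}"
      proof safe
        fix k' j assume "k' \<in> M"
        with k obtain x x' where x: "x \<in> U i" "x \<in> cball (q k) \<rho>'" "x' \<in> U i" "x' \<in> cball (q k') \<rho>'"
          by (auto simp: M_def)
        have "dist (y k) (y k') \<le> dist (y k) x + dist x x' + dist (y k') x'"
          by (smt (verit) dist_triangle dist_commute)
        also have "\<dots> \<le> D i + \<delta>" using near[OF x(2)] near[OF x(4)] U[OF x(1,3)] by linarith
        finally have "norm (y k' - y k) \<le> D i + \<delta>" by (simp add: dist_norm norm_minus_commute)
        then have "\<bar>(y k' - y k) $ j\<bar> \<le> D i + \<delta>" using component_le_norm_cart order_trans by blast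
        also have "(y k' - y k) $ j = \<delta> * real_of_int (k' $ j - k $ j)"
          by (simp add: y_def real_vec_def algebra_simps)
        finally have "\<delta> * \<bar>real_of_int (k' $ j - k $ j)\<bar> \<le> D i + \<delta>"
          using pos by (simp only: abs_mult abs_of_pos)
        then have "real_of_int \<bar>k' $ j - k $ j\<bar> \<le> D i / \<delta> + 1"
          using pos by (simp add: field_simps)
        then show "\<bar>k' $ j - k $ j\<bar> \<le> t" unfolding t_def by (simp only: le_floor_iff)
      qed
      then have "card M \<le> nat (2 * t + 1) ^ d"
        unfolding d_def card_int_cube[OF t0, of k, symmetric] by (intro card_mono finite_int_cube[OF t0])
      then have "real (card M) \<le> real (nat (2 * t + 1)) ^ d"
        by (metis of_nat_le_iff of_nat_power)
      also have "\<dots> \<le> (5 * max \<delta> (D i) / \<delta>) ^ d"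
      proof (rule power_mono)
        have "real (nat (2 * t + 1)) = 2 * real_of_int t + 1" using t0 by simp
        also have "\<dots> \<le> 2 * (D i / \<delta> + 1) + 1"
          unfolding t_def by (intro add_right_mono mult_left_mono of_int_floor_le) auto
        also have "\<dots> \<le> 5 * max \<delta> (D i) / \<delta>"
          using pos by (simp add: field_simps max_def)
        finally show "real (nat (2 * t + 1)) \<le> 5 * max \<delta> (D i) / \<delta>" .
      qed simp
      finally show ?thesis .
    qed (use pos in \<open>simp add: le_max_iff_disj\<close>)
    have N_ge: "(\<rho> / (2 * real d * \<delta>)) ^ d \<le> N"
    proof -
      have "\<rho> / (2 * real d * \<delta>) \<le> m + 1" unfolding m_def by linarith
      also have "\<dots> \<le> real (nat (2 * m + 1))" using m0 by simp
      finally show ?thesis using N pos by (simp add: power_mono)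
    qed
    have "(10 * real d) ^ d * max \<delta> (D i) ^ d * w * \<rho> powr s \<le> D i powr s * \<rho>' powr s * \<rho> ^ d"
      unfolding w_def using assms pos Di D(1) by (intro child_weight_le[where c = c]) auto
    then have "(10 * real d) ^ d * max \<delta> (D i) ^ d * w * \<rho> powr s / ((2 * real d * \<delta>) ^ d * \<rho> powr s)
        \<le> D i powr s * \<rho>' powr s * \<rho> ^ d / ((2 * real d * \<delta>) ^ d * \<rho> powr s)"
      using pos by (intro divide_right_mono) auto
    moreover have "5 * max \<delta> (D i) / \<delta> = (10 * real d * max \<delta> (D i)) / (2 * real d * \<delta>)"
      using pos d by simp
    then have "(5 * max \<delta> (D i) / \<delta>) ^ d = (10 * real d) ^ d * max \<delta> (D i) ^ d / (2 * real d * \<delta>) ^ d"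
      by (simp only: power_divide power_mult_distrib)
    ultimately have "(5 * max \<delta> (D i) / \<delta>) ^ d * w \<le> (\<rho> / (2 * real d * \<delta>)) ^ d * (\<rho>' powr s / \<rho> powr s * D i powr s)"
      using pos by (simp add: power_divide mult_ac)
    also have "\<dots> \<le> N * (\<rho>' powr s / \<rho> powr s * D i powr s)"
      using N_ge by (intro mult_right_mono) auto
    finally have "(5 * max \<delta> (D i) / \<delta>) ^ d * w \<le> N * \<rho>' powr s / \<rho> powr s * g i"
      using meets by (simp add: g_def)
    then show ?thesis unfolding sum_eq using mult_right_mono[OF card_M w0] by linarith
  qed
  \<comment> \<open>Pigeonhole: some cell carries at most the average truncated weight.\<close>
  have "\<exists>k\<in>K. (\<Sum>i. f i k) \<le> c * \<rho>' powr s"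
  proof (rule ccontr)
    assume "\<not> ?thesis"
    moreover have "K \<noteq> {}" using N0 by (auto simp: N_def)
    ultimately have "(\<Sum>k\<in>K. c * \<rho>' powr s) < (\<Sum>k\<in>K. \<Sum>i. f i k)"
      using N(1) by (intro sum_strict_mono) (auto simp: not_le)
    also have "\<dots> = (\<Sum>i. \<Sum>k\<in>K. f i k)" by (rule suminf_sum[symmetric]) (rule sum_f)
    also have "\<dots> \<le> (\<Sum>i. N * \<rho>' powr s / \<rho> powr s * g i)"
      by (intro suminf_le cell_sum summable_sum sum_f summable_mult sum_g)
    also have "\<dots> = N * \<rho>' powr s / \<rho> powr s * suminf g" by (rule suminf_mult[OF sum_g])
    also have "\<dots> \<le> N * \<rho>' powr s / \<rho> powr s * (c * \<rho> powr s)"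
      using g_inv by (intro mult_left_mono) auto
    also have "\<dots> = (\<Sum>k\<in>K. c * \<rho>' powr s)" using pos by (simp add: N_def)
    finally show False by simp
  qed
  then obtain k where k: "k \<in> K" "(\<Sum>i. f i k) \<le> c * \<rho>' powr s" by blast
  have "f i k = (if U i \<inter> cball (q k) \<rho>' \<noteq> {} then D i powr s else 0)" for i
  proof -
    have "f i k \<le> (\<Sum>i. f i k)"
      using sum_le_suminf[OF sum_f, of "{i}"] by (simp add: f_def)
    also have "\<dots> \<le> c * \<rho>' powr s" by (rule k)
    also have "\<dots> < 1 * \<rho>' powr s" using c rho by (intro mult_strict_right_mono) auto
    finally show ?thesis by (auto simp: f_def min_def split: if_splits)
  qed
  then show ?thesis using k q(1) sub[OF k(1)] by (intro bexI[of _ "q k"]) auto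
qed

text \<open>
  A substitute for the mass transference principle: centres P n that are dense at scale \<delta> n, with balls of
  radius \<rho> n inside G n, where \<rho> n ^ s dominates \<delta> n ^ d, produce in every ball a point of the limsup of
  the G n outside any family U with sufficiently small weight. It is obtained by iterating
  \<open>ex_child_ball\<close> and intersecting the nested balls.
\<close>
lemma limsup_escapes_cover:
  fixes p :: "real^'n" and U :: "nat \<Rightarrow> (real^'n) set" and D \<delta> \<rho> :: "nat \<Rightarrow> real" and c s :: real
    and G P :: "nat \<Rightarrow> (real^'n) set"
  defines "d \<equiv> CARD('n)"
  assumes s: "0 < s" "s < real d" and c: "0 < c" "c < 1" "(10 * real d) ^ d * c powr ((d - s) / s) \<le> 1"
    and S: "infinite S"
    and P: "\<And>n y. n \<in> S \<Longrightarrow> \<exists>q\<in>P n. dist y q \<le> \<delta> n / 4"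
    and G: "\<And>n q. n \<in> S \<Longrightarrow> q \<in> P n \<Longrightarrow> cball q (\<rho> n) \<subseteq> G n"
    and pos: "\<And>n. 0 < \<delta> n" "\<And>n. 0 < \<rho> n"
    and lim: "\<delta> \<longlonglongrightarrow> 0" "(\<lambda>n. \<rho> n / \<delta> n) \<longlonglongrightarrow> 0" "(\<lambda>n. \<delta> n ^ d / \<rho> n powr s) \<longlonglongrightarrow> 0"
    and U: "\<And>i x y. x \<in> U i \<Longrightarrow> y \<in> U i \<Longrightarrow> dist x y \<le> D i"
    and D: "\<And>i. 0 < D i" "summable (\<lambda>i. D i powr s)"
    and r: "0 < r" "(\<Sum>i. D i powr s) \<le> c * r powr s"
  shows "\<exists>x\<in>cball p r. infinite {n. x \<in> G n} \<and> (\<forall>i. x \<notin> U i)"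
proof -
  define wt where "wt B i = (if U i \<inter> B \<noteq> {} then D i powr s else 0)" for B i
  have sum_wt: "summable (wt B)" for B
    by (rule summable_comparison_test'[OF D(2), of 0]) (auto simp: wt_def)
  define good where "good p r \<longleftrightarrow> 0 < r \<and> suminf (wt (cball p r)) \<le> c * r powr s" for p r
  have d: "d \<ge> 1" by (simp add: d_def Suc_leI)
  have step: "\<exists>n q. m < n \<and> \<rho> n \<le> r / 2 \<and> good q (\<rho> n) \<and> cball q (\<rho> n) \<subseteq> cball p r \<inter> G n"
    if gd: "good p r" for m p r
  proof -
    have r0: "0 < r" using gd by (simp add: good_def)
    have "0 < r ^ d / ((10 * real d) ^ d * r powr s)" using r0 d by simp
    then have "\<forall>\<^sub>F n in sequentially. \<delta> n < r \<and> \<rho> n / \<delta> n < 1/4 \<and> \<delta> n ^ d / \<rho> n powr s < r ^ d / ((10 * real d) ^ d * r powr s)"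
      using r0 by (intro eventually_conj order_tendstoD[OF lim(1)] order_tendstoD[OF lim(2)] order_tendstoD[OF lim(3)]) auto
    then obtain n0 where n0: "\<And>n. n \<ge> n0 \<Longrightarrow> \<delta> n < r \<and> \<rho> n / \<delta> n < 1/4 \<and> \<delta> n ^ d / \<rho> n powr s < r ^ d / ((10 * real d) ^ d * r powr s)"
      by (auto simp: eventually_sequentially)
    obtain n where n: "n \<in> S" "n > max m n0" using S unfolding infinite_nat_iff_unbounded by blast
    have rd: "\<delta> n < r" "\<rho> n \<le> \<delta> n / 4"
      using n0[of n] n pos[of n] by (auto simp: field_simps)
    have K: "(10 * real d) ^ d * \<delta> n ^ d * r powr s \<le> \<rho> n powr s * r ^ d"
      using n0[of n] n pos[of n] r0 d by (simp add: field_simps)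
    have "\<exists>q\<in>P n. cball q (\<rho> n) \<subseteq> cball p r \<and>
        (\<Sum>i. if U i \<inter> cball q (\<rho> n) \<noteq> {} then D i powr s else 0) \<le> c * \<rho> n powr s"
      using gd rd K n pos
      by (intro ex_child_ball[where \<delta> = "\<delta> n"] s[unfolded d_def] c[unfolded d_def] P U D)
         (auto simp: good_def wt_def[abs_def] d_def)
    then obtain q where "q \<in> P n" "cball q (\<rho> n) \<subseteq> cball p r" "good q (\<rho> n)"
      using pos by (auto simp: good_def wt_def[abs_def])
    then show ?thesis using G[OF n(1)] n(2) rd pos[of n] by (intro exI[of _ n] exI[of _ q]) auto
  qed
  have good0: "good p r"
  proof -
    have "suminf (wt (cball p r)) \<le> (\<Sum>i. D i powr s)"
      by (intro suminf_le sum_wt D) (auto simp: wt_def)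
    then show ?thesis using r by (simp add: good_def)
  qed
  \<comment> \<open>A state consists of the centre and the radius of the current ball and its index.
    The index of the starting ball is a dummy.\<close>
  define Inv where "Inv k z \<longleftrightarrow> (case z of (q, t, n :: nat) \<Rightarrow> good q t \<and> (k = 0 \<longrightarrow> q = p \<and> t = r))" for k :: nat and z
  define Nxt where "Nxt z z' \<longleftrightarrow> (case z of (q, t, n :: nat) \<Rightarrow> case z' of (q', t', n' :: nat) \<Rightarrow>
     n < n' \<and> t' \<le> t / 2 \<and> cball q' t' \<subseteq> cball q t \<inter> G n')" for z z'
  have "\<exists>z. \<forall>k. Inv k (z k) \<and> Nxt (z k) (z (Suc k))"
  proof (rule dependent_nat_choice)
    show "\<exists>z. Inv 0 z" using good0 by (intro exI[of _ "(p, r, 0)"]) (simp add: Inv_def)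
    fix z k assume "Inv k z"
    then obtain q t n where z: "z = (q, t, n)" "good q t" by (cases z) (auto simp: Inv_def)
    from step[OF z(2), of n] obtain n' q' where
      "n < n'" "\<rho> n' \<le> t / 2" "good q' (\<rho> n')" "cball q' (\<rho> n') \<subseteq> cball q t \<inter> G n'" by blast
    then show "\<exists>z'. Inv (Suc k) z' \<and> Nxt z z'"
      by (intro exI[of _ "(q', \<rho> n', n')"]) (simp add: Inv_def Nxt_def z)
  qed
  then obtain z where z: "\<And>k. Inv k (z k)" "\<And>k. Nxt (z k) (z (Suc k))" by blast
  define q where "q k = fst (z k)" for k
  define t where "t k = fst (snd (z k))" for k
  define N where "N k = snd (snd (z k))" for k
  have zk: "z k = (q k, t k, N k)" for k by (simp add: q_def t_def N_def)
  have gd: "good (q k) (t k)" for k using z(1)[of k] by (simp add: Inv_def zk)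
  have init: "q 0 = p" "t 0 = r" using z(1)[of 0] by (simp_all add: Inv_def zk)
  have nx: "N k < N (Suc k)" "t (Suc k) \<le> t k / 2" "cball (q (Suc k)) (t (Suc k)) \<subseteq> cball (q k) (t k)"
    "cball (q (Suc k)) (t (Suc k)) \<subseteq> G (N (Suc k))" for k
    using z(2)[of k] by (simp_all add: Nxt_def zk)
  have t_pos: "0 < t k" for k using gd[of k] by (simp add: good_def)
  have t_le: "t k \<le> r / 2 ^ k" for k
  proof (induction k)
    case (Suc k)
    then show ?case using nx(2)[of k] by simp
  qed (simp add: init)
  have "(\<lambda>k. r / 2 ^ k) \<longlonglongrightarrow> 0" by real_asymp
  have "\<Inter>(range (\<lambda>k. cball (q k) (t k))) \<noteq> {}"
  proof (rule compact_nest)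
    show "cball (q n) (t n) \<subseteq> cball (q m) (t m)" if "m \<le> n" for m n
      using lift_Suc_antimono_le[of "\<lambda>k. cball (q k) (t k)", OF nx(3) that] .
    show "cball (q n) (t n) \<noteq> {}" for n using t_pos[of n] by simp
  qed simp
  then obtain x where x: "\<And>k. x \<in> cball (q k) (t k)" by blast
  have "x \<notin> U i" for i
  proof
    assume "x \<in> U i"
    have "D i \<le> t k" for k
    proof -
      have "U i \<inter> cball (q k) (t k) \<noteq> {}" using x \<open>x \<in> U i\<close> by blast
      then have "D i powr s = sum (wt (cball (q k) (t k))) {i}" by (simp add: wt_def)
      also have "\<dots> \<le> suminf (wt (cball (q k) (t k)))"
        by (rule sum_le_suminf[OF sum_wt]) (auto simp: wt_def)
      also have "\<dots> \<le> c * t k powr s" using gd by (simp add: good_def)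
      also have "\<dots> \<le> 1 * t k powr s" using c by (intro mult_right_mono) auto
      finally show ?thesis using powr_less_mono2[OF s(1), of "t k" "D i"] t_pos[of k] by fastforce
    qed
    then have "D i \<le> r / 2 ^ k" for k using t_le order_trans by blast
    then have "D i \<le> 0" using LIMSEQ_le_const[OF \<open>(\<lambda>k. r / 2 ^ k) \<longlonglongrightarrow> 0\<close>] by blast
    then show False using D(1)[of i] by simp
  qed
  moreover have "infinite {n. x \<in> G n}"
  proof -
    have "strict_mono N" using nx(1) by (simp add: strict_mono_Suc_iff)
    then have "infinite (range (\<lambda>k. N (Suc k)))"
      by (intro range_inj_infinite) (auto simp: inj_on_def strict_mono_eq)
    moreover have "range (\<lambda>k. N (Suc k)) \<subseteq> {n. x \<in> G n}" using nx(4) x by blast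
    ultimately show ?thesis using finite_subset by blast
  qed
  ultimately show ?thesis using x[of 0] init by blast
qed

section \<open>Null sets of the Hausdorff measure\<close>

text \<open>
  The Hausdorff--Cantelli lemma: the tails of the families F n cover the limsup set.
\<close>
lemma hausdorff_measure_limsup_eq_0:
  fixes F :: "nat \<Rightarrow> 'a::metric_space set set" and K r :: "nat \<Rightarrow> real"
  assumes "0 < s"
    and cover: "\<And>x. x \<in> E \<Longrightarrow> infinite {n. x \<in> \<Union>(F n)}"
    and F: "\<And>n. n \<ge> n0 \<Longrightarrow> finite (F n)" "\<And>n. n \<ge> n0 \<Longrightarrow> card (F n) \<le> K n"
    and diam: "\<And>n V. n \<ge> n0 \<Longrightarrow> V \<in> F n \<Longrightarrow> bounded V \<and> diameter V \<le> r n"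
    and r: "\<And>n. 0 \<le> r n" "r \<longlonglongrightarrow> 0"
    and sum: "summable (\<lambda>n. K n * r n powr s)"
  shows "hausdorff_measure s E = 0"
proof -
  have "hausdorff_premeasure s \<delta> E \<le> 0 + ennreal e" if "\<delta> > 0" "e > 0" for \<delta> e
  proof -
    obtain n1 where n1: "\<And>n. n \<ge> n1 \<Longrightarrow> r n < \<delta>"
      using order_tendstoD(2)[OF r(2) \<open>\<delta> > 0\<close>] by (auto simp: eventually_sequentially)
    obtain n2 where n2: "\<And>n. n \<ge> n2 \<Longrightarrow> norm (\<Sum>i. K (i + n) * r (i + n) powr s) < e"
      using suminf_exist_split[OF \<open>e > 0\<close> sum] by blast
    define N where "N = max n0 (max n1 n2)"
    have "\<exists>h. bij_betw h {0..<card (F (n + N))} (F (n + N))" for n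
      by (intro ex_bij_betw_nat_finite F) (simp add: N_def)
    then obtain h where h: "\<And>n. bij_betw (h n) {0..<card (F (n + N))} (F (n + N))" by metis
    have h_in: "h n m \<in> F (n + N)" if "m < card (F (n + N))" for n m
      using bij_betwE[OF h[of n]] that by auto
    \<comment> \<open>The doubly indexed tail cover, padded with empty sets, which contribute 0 to the sums.\<close>
    define V where "V = (\<lambda>(n, m). if m < card (F (n + N)) then h n m else {})"
    have V: "bounded (V z) \<and> diameter (V z) \<le> \<delta>" for z
    proof (cases z)
      case (Pair n m)
      show ?thesis
      proof (cases "m < card (F (n + N))")
        case True
        have "n + N \<ge> n0" "n + N \<ge> n1" by (auto simp: N_def)
        then show ?thesis using diam[OF _ h_in[OF True]] n1[of "n + N"] True by (auto simp: Pair V_def)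
      qed (use \<open>\<delta> > 0\<close> in \<open>simp add: Pair V_def\<close>)
    qed
    have "E \<subseteq> (\<Union>i. V (prod_decode i))"
    proof
      fix x assume "x \<in> E"
      then have "\<exists>n\<ge>N. x \<in> \<Union>(F n)"
        using cover[of x] unfolding infinite_nat_iff_unbounded_le by blast
      then obtain n where n: "n \<ge> N" "x \<in> \<Union>(F n)" by blast
      define c where "c = card (F n)"
      have "F n = h (n - N) ` {0..<c}"
        using bij_betw_imp_surj_on[OF h[of "n - N"]] n by (simp add: c_def)
      then obtain m where "m < c" "x \<in> h (n - N) m" using n by auto
      then have "x \<in> V (n - N, m)" using n by (simp add: V_def c_def)
      then have "x \<in> V (prod_decode (prod_encode (n - N, m)))" by simp
      then show "x \<in> (\<Union>i. V (prod_decode i))" by blast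
    qed
    then have "hausdorff_premeasure s \<delta> E \<le> (\<Sum>i. ennreal (diameter_powr s (V (prod_decode i))))"
      unfolding hausdorff_premeasure_def
      by (intro INF_lower2[of "\<lambda>i. V (prod_decode i)"]) (use V in auto)
    also have "\<dots> = (\<Sum>n. \<Sum>m. ennreal (diameter_powr s (V (n, m))))"
      by (rule suminf_ennreal_2dimen[of _ "\<lambda>z. ennreal (diameter_powr s (V z))"]) simp
    also have "\<dots> \<le> (\<Sum>n. ennreal (K (n + N) * r (n + N) powr s))"
    proof (intro suminf_le summableI)
      fix n
      have "(\<Sum>m. ennreal (diameter_powr s (V (n, m)))) = (\<Sum>m<card (F (n + N)). ennreal (diameter_powr s (V (n, m))))"
        by (rule suminf_finite) (auto simp: V_def diameter_powr_def)
      also have "\<dots> \<le> (\<Sum>m<card (F (n + N)). ennreal (r (n + N) powr s))"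
      proof (intro sum_mono ennreal_leI)
        fix m assume "m \<in> {..<card (F (n + N))}"
        then have m: "h n m \<in> F (n + N)" "V (n, m) = h n m" using h_in by (auto simp: V_def)
        have "diameter (h n m) powr s \<le> r (n + N) powr s"
          using diam[OF _ m(1)] \<open>0 < s\<close> diameter_ge_0[of "h n m"] by (intro powr_mono2) (auto simp: N_def)
        then show "diameter_powr s (V (n, m)) \<le> r (n + N) powr s"
          using \<open>0 < s\<close> by (simp add: m diameter_powr_def)
      qed
      also have "\<dots> = ennreal (real (card (F (n + N))) * r (n + N) powr s)"
        by (simp add: ennreal_mult ennreal_of_nat_eq_real_of_nat)
      also have "\<dots> \<le> ennreal (K (n + N) * r (n + N) powr s)"
        using F(2)[of "n + N"] by (intro ennreal_leI mult_right_mono) (auto simp: N_def)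
      finally show "(\<Sum>m. ennreal (diameter_powr s (V (n, m)))) \<le> ennreal (K (n + N) * r (n + N) powr s)" .
    qed
    also have "\<dots> = ennreal (\<Sum>n. K (n + N) * r (n + N) powr s)"
    proof (rule suminf_ennreal2)
      show "summable (\<lambda>n. K (n + N) * r (n + N) powr s)"
        using sum summable_iff_shift[of "\<lambda>n. K n * r n powr s" N] by blast
      fix n
      have "0 \<le> K (n + N)" using F(2)[of "n + N"] of_nat_0_le_iff order_trans unfolding N_def by fastforce
      then show "0 \<le> K (n + N) * r (n + N) powr s" by simp
    qed
    also have "\<dots> \<le> ennreal e"
    proof (rule ennreal_leI)
      have "n2 \<le> N" by (simp add: N_def)
      then show "(\<Sum>n. K (n + N) * r (n + N) powr s) \<le> e" using n2[of N] by simp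
    qed
    finally show ?thesis by simp
  qed
  then have "hausdorff_premeasure s \<delta> E \<le> 0" if "\<delta> > 0" for \<delta>
    using ennreal_le_epsilon[of 0] that by blast
  then show ?thesis unfolding hausdorff_measure_def by (auto intro: antisym SUP_least)
qed

lemma hausdorff_measure_eq_0_cover:
  fixes E :: "'a::metric_space set"
  assumes "hausdorff_measure s E = 0" "0 < e"
  shows "\<exists>U :: nat \<Rightarrow> 'a set. E \<subseteq> (\<Union>i. U i) \<and> (\<forall>i. bounded (U i)) \<and>
      (\<Sum>i. ennreal (diameter_powr s (U i))) < ennreal e"
proof -
  have "hausdorff_premeasure s 1 E \<le> hausdorff_measure s E"
    unfolding hausdorff_measure_def by (rule SUP_upper) simp
  then have "hausdorff_premeasure s 1 E < ennreal e" using assms by simp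
  then show ?thesis unfolding hausdorff_premeasure_def INF_less_iff by blast
qed

lemma diameter_powr_nonneg: "0 \<le> diameter_powr s U"
  by (simp add: diameter_powr_def)

lemma hausdorff_measure_0_eq_0:
  assumes "hausdorff_measure 0 E = 0"
  shows "E = {}"
proof -
  obtain U :: "nat \<Rightarrow> _" where U: "E \<subseteq> (\<Union>i. U i)" "(\<Sum>i. ennreal (diameter_powr 0 (U i))) < ennreal 1"
    using hausdorff_measure_eq_0_cover[OF assms, of 1] by auto
  have "U i = {}" for i
  proof (rule ccontr)
    assume "U i \<noteq> {}"
    then have "ennreal 1 = (\<Sum>i\<in>{i}. ennreal (diameter_powr 0 (U i)))" by (simp add: diameter_powr_def)
    also have "\<dots> \<le> (\<Sum>i. ennreal (diameter_powr 0 (U i)))" by (rule sum_le_suminf) auto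
    finally show False using U(2) by simp
  qed
  then show ?thesis using U by simp
qed

section \<open>Lifting the recurrence condition to the universal cover\<close>

lemma dist_abs_torus_less_iff:
  "dist (abs_torus x) (abs_torus y) < e \<longleftrightarrow> (\<exists>k\<in>integer_lattice. norm (x - y - k) < e)"
proof
  assume "dist (abs_torus x) (abs_torus y) < e"
  then obtain x' y' where *: "abs_torus x' = abs_torus x" "abs_torus y' = abs_torus y" "dist x' y' < e"
    by (rule dist_torus_less)
  have "x - x' \<in> integer_lattice" "y' - y \<in> integer_lattice" using * abs_torus_eq_iff by metis+
  then have "(x - x') + (y' - y) \<in> integer_lattice" by (rule integer_lattice_add)
  moreover have "x - y - ((x - x') + (y' - y)) = x' - y'" by simp
  ultimately show "\<exists>k\<in>integer_lattice. norm (x - y - k) < e" using * by (metis dist_norm)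
next
  assume "\<exists>k\<in>integer_lattice. norm (x - y - k) < e"
  then obtain k where k: "k \<in> integer_lattice" "norm (x - y - k) < e" by blast
  have "abs_torus (x - k) = abs_torus x"
    using k integer_lattice_minus by (simp add: abs_torus_eq_iff)
  then have "dist (abs_torus x) (abs_torus y) \<le> dist (x - k) y" using dist_torus_le by metis
  then show "dist (abs_torus x) (abs_torus y) < e" using k by (simp add: dist_norm algebra_simps)
qed

text \<open>
  A nonzero lattice vector has norm at least 1, so the projection is isometric at distances up to 1/2.
\<close>
lemma dist_abs_torus_eq:
  assumes "dist x y \<le> 1 / 2"
  shows "dist (abs_torus x) (abs_torus y) = dist x y"
proof (rule antisym[OF dist_torus_le], rule ccontr)
  assume "\<not> dist x y \<le> dist (abs_torus x) (abs_torus y)"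
  then obtain k where k: "k \<in> integer_lattice" "norm (x - y - k) < dist x y"
    by (auto simp: not_le dist_abs_torus_less_iff)
  then have "k \<noteq> 0" by (auto simp: dist_norm)
  then obtain i where "k $ i \<noteq> 0" by (auto simp: vec_eq_iff)
  then have "1 \<le> \<bar>k $ i\<bar>" using k Ints_nonzero_abs_ge1 by (auto simp: integer_lattice_def)
  then have "1 \<le> norm k" using component_le_norm_cart[of k i] by linarith
  also have "norm k \<le> norm (x - y) + norm (x - y - k)"
    using norm_triangle_ineq4[of "x - y" "x - y - k"] by simp
  finally show False using k assms by (simp add: dist_norm)
qed

lemma torus_map_funpow:
  "(torus_map A ^^ n) (abs_torus x) = abs_torus ((((*v) (map_matrix of_int A)) ^^ n) x)"
  by (induction n) (simp_all add: torus_map.abs_eq)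

lemma integer_lattice_eq_range: "integer_lattice = range real_vec"
proof
  show "integer_lattice \<subseteq> range real_vec"
  proof
    fix k :: "real^'n" assume "k \<in> integer_lattice"
    then have "k = real_vec (\<chi> i. \<lfloor>k $ i\<rfloor>)"
      by (auto simp: integer_lattice_def real_vec_def vec_eq_iff elim!: Ints_cases)
    then show "k \<in> range real_vec" by blast
  qed
qed (auto simp: integer_lattice_def real_vec_def)

lemma abs_torus_unit_cube:
  obtains x :: "real^'n" where "p = abs_torus x" "norm x \<le> CARD('n)"
proof -
  obtain y where y: "p = abs_torus y" using abs_torus_surj by blast
  define x where "x = (\<chi> i. frac (y $ i))"
  have "y - x \<in> integer_lattice" by (simp add: x_def integer_lattice_def frac_def)
  then have "p = abs_torus x" using y abs_torus_eq_iff by metis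
  moreover have "norm x \<le> CARD('n)"
  proof -
    have "norm x \<le> (\<Sum>i\<in>UNIV. \<bar>x $ i\<bar>)" by (rule norm_le_l1_cart)
    also have "\<dots> \<le> (\<Sum>i\<in>(UNIV::'n set). 1)"
      by (intro sum_mono) (simp add: x_def frac_lt_1 less_imp_le)
    finally show ?thesis by simp
  qed
  ultimately show ?thesis using that by blast
qed

definition displacement :: "int^'n^'n \<Rightarrow> nat \<Rightarrow> real^'n \<Rightarrow> real^'n" where
  "displacement A n x = (((*v) (map_matrix of_int A)) ^^ n) x - x"

lemma linear_displacement:
  fixes A :: "int^'n^'n"
  shows "linear (displacement A n)"
proof -
  have "linear (((*v) (map_matrix of_int A :: real^'n^'n)) ^^ n)"
  proof (induction n)
    case (Suc n)
    then show ?case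
      unfolding funpow.simps by (rule linear_compose) (rule matrix_vector_mul_linear)
  qed (simp add: id_def linear_ident)
  then show ?thesis unfolding displacement_def[abs_def] by (intro linear_compose_sub linear_ident)
qed

lemma mem_recurrence_set_iff:
  "abs_torus x \<in> recurrence_set (torus_map A) \<psi> \<longleftrightarrow>
     infinite {n. 1 \<le> n \<and> (\<exists>k. norm (displacement A n x - real_vec k) < \<psi> n)}"
proof -
  have "(torus_map A ^^ n) (abs_torus x) \<in> ball (abs_torus x) (\<psi> n) \<longleftrightarrow>
      (\<exists>k. norm (displacement A n x - real_vec k) < \<psi> n)" for n
    by (simp add: mem_ball dist_commute[of "abs_torus x"] torus_map_funpow dist_abs_torus_less_iff
        integer_lattice_eq_range displacement_def)
  then show ?thesis by (simp add: recurrence_set_def)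
qed

text \<open>
  For large n the identity is negligible against A^n, because b > 0.
\<close>
lemma displacement_bounds:
  fixes A :: "int^'n^'n"
  assumes eig: "\<And>c. complex_eigenvalue A c \<Longrightarrow> cmod c = lam" and "1 < lam"
    and ab: "0 < b" "b < ln lam" "ln lam < a"
  obtains C n0 where "C \<ge> 1"
    "\<And>n v. norm (displacement A n v) \<le> (C + 1) * exp (a * real n) * norm v"
    "\<And>n v. n \<ge> n0 \<Longrightarrow> exp (b * real n) * norm v \<le> 2 * C * norm (displacement A n v)"
proof -
  define f where "f = (*v) (map_matrix of_int A :: real^'n^'n)"
  obtain C where C: "C \<ge> 1" "\<And>n v. norm ((f ^^ n) v) \<le> C * exp (a * real n) * norm v"
      "\<And>n v. exp (b * real n) * norm v \<le> C * norm ((f ^^ n) v)"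
    using integer_matrix_growth[where A = A and lam = lam and b = b and a = a, OF eig] \<open>1 < lam\<close> ab unfolding f_def by (auto simp: f_def)
  have disp: "displacement A n v = (f ^^ n) v - v" for n v by (simp add: displacement_def f_def)
  have "filterlim (\<lambda>n. exp (b * real n)) at_top sequentially" using ab by real_asymp
  then obtain n0 where n0: "\<And>n. n \<ge> n0 \<Longrightarrow> 2 * C \<le> exp (b * real n)"
    by (auto simp: filterlim_at_top eventually_sequentially)
  show ?thesis
  proof (rule that[OF C(1)])
    fix n and v :: "real^'n"
    have "norm (displacement A n v) \<le> norm ((f ^^ n) v) + norm v"
      unfolding disp by (rule norm_triangle_ineq4)
    also have "\<dots> \<le> C * exp (a * real n) * norm v + exp (a * real n) * norm v"
      using ab C(2) by (intro add_mono) (auto intro: mult_left_le_one_le simp: mult_le_cancel_right1)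
    finally show "norm (displacement A n v) \<le> (C + 1) * exp (a * real n) * norm v"
      by (simp add: algebra_simps)
    assume n: "n \<ge> n0"
    have "norm ((f ^^ n) v) \<le> norm (displacement A n v) + norm v"
      unfolding disp using norm_triangle_ineq[of "(f ^^ n) v - v" v] by simp
    then have "C * norm ((f ^^ n) v) \<le> C * (norm (displacement A n v) + norm v)"
      using C(1) by (intro mult_left_mono) auto
    moreover have "2 * C * norm v \<le> exp (b * real n) * norm v"
      using n0[OF n] by (intro mult_right_mono) auto
    ultimately show "exp (b * real n) * norm v \<le> 2 * C * norm (displacement A n v)"
      using C(3)[of n v] by (simp add: algebra_simps)
  qed
qed

section \<open>The upper bound\<close>

lemma tendsto_exp_neg:
  fixes c :: real assumes "0 < c"
  shows "(\<lambda>n. exp (- c * real n)) \<longlonglongrightarrow> 0"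
  using assms by real_asymp

lemma summable_exp_neg:
  fixes c :: real assumes "0 < c"
  shows "summable (\<lambda>n. exp (- c * real n))"
proof -
  have "summable (\<lambda>n. exp (- c) ^ n)" using assms by (intro summable_geometric) simp
  moreover have "exp (- c) ^ n = exp (- c * real n)" for n by (metis exp_of_nat_mult mult.commute)
  ultimately show ?thesis by simp
qed

lemma exp_powr: "exp (x::real) powr s = exp (x * s)"
  by (simp add: powr_def mult.commute)

text \<open>
  The map A^n - I. Its zeros modulo the integer lattice are the points of period n.
\<close>

lemma small_perturbation:
  fixes \<eta> L t :: real
  assumes "0 < \<eta>" "0 < L" "0 < t"
  obtains \<epsilon> where "0 < \<epsilon>" "\<epsilon> \<le> L / 2" "\<epsilon> * t < \<eta>"
proof (rule that[of "min (L / 2) (\<eta> / (2 * t))"])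
  have "min (L / 2) (\<eta> / (2 * t)) * t \<le> \<eta> / (2 * t) * t"
    using assms by (intro mult_right_mono) auto
  also have "\<dots> < \<eta>" using assms by simp
  finally show "min (L / 2) (\<eta> / (2 * t)) * t < \<eta>" .
qed (use assms in auto)

text \<open>
  The integer vectors k in B n are the only ones that can be close to A^n x - x for x of norm at most d,
  and the set V n k of these x that belong to k has diameter at most r n because A^n - I expands.
  The margin \<eta> in the hypothesis on s leaves room to replace ln lam by nearby rates b < a.
\<close>
lemma hausdorff_measure_recurrence_set_eq_0:
  fixes A :: "int^'n^'n"
  assumes eig: "\<And>c. complex_eigenvalue A c \<Longrightarrow> cmod c = lam" and "1 < lam"
    and psi: "\<psi> \<longlonglongrightarrow> 0" "\<forall>\<^sub>F n in sequentially. \<psi> n \<le> exp (- \<beta> * real n)"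
    and s: "0 < s" "real CARD('n) * ln lam < s * (\<beta> + ln lam)"
  shows "hausdorff_measure s (recurrence_set (torus_map A) \<psi>) = 0"
proof -
  define d where "d = CARD('n)"
  have d: "d \<ge> 1" by (simp add: d_def Suc_leI)
  define L where "L = ln lam"
  have L: "0 < L" using \<open>1 < lam\<close> by (simp add: L_def)
  define \<eta> where "\<eta> = s * (\<beta> + L) - d * L"
  have \<eta>: "\<eta> > 0" using s by (simp add: \<eta>_def d_def L_def)
  obtain \<epsilon> where \<epsilon>: "0 < \<epsilon>" "\<epsilon> \<le> L / 2" "\<epsilon> * (d + s) < \<eta>"
    using small_perturbation[OF \<eta> L, of "d + s"] s d by auto
  have ab: "d * (L + \<epsilon>) < s * (\<beta> + (L - \<epsilon>))" using \<epsilon>(3) by (simp add: \<eta>_def algebra_simps)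
  define a where "a = L + \<epsilon>"
  define b where "b = L - \<epsilon>"
  have a: "0 < a" "ln lam < a" and b: "0 < b" "b < ln lam"
    using \<epsilon> L by (auto simp: a_def b_def L_def)
  define \<kappa> where "\<kappa> = s * (\<beta> + b) - d * a"
  have \<kappa>: "0 < \<kappa>" using ab by (simp add: \<kappa>_def a_def b_def)
  have "0 < s * (\<beta> + b)" using \<kappa> a d by (smt (verit) \<kappa>_def mult_nonneg_nonneg of_nat_0_le_iff)
  then have \<beta>b: "0 < \<beta> + b" using s by (simp add: zero_less_mult_iff)
  obtain C n1 where C: "C \<ge> 1"
    "\<And>n v. norm (displacement A n v) \<le> (C + 1) * exp (a * real n) * norm v"
    "\<And>n v. n \<ge> n1 \<Longrightarrow> exp (b * real n) * norm v \<le> 2 * C * norm (displacement A n v)"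
    using displacement_bounds[OF eig \<open>1 < lam\<close> b a(2)] by blast
  have "\<forall>\<^sub>F n in sequentially. \<psi> n \<le> exp (- \<beta> * real n) \<and> \<psi> n < 1 \<and> n \<ge> n1"
    using psi(2) order_tendstoD(2)[OF psi(1) zero_less_one] eventually_ge_at_top[of n1]
    by eventually_elim auto
  then obtain n0 where n0: "\<And>n. n \<ge> n0 \<Longrightarrow> \<psi> n \<le> exp (- \<beta> * real n) \<and> \<psi> n < 1 \<and> n \<ge> n1"
    by (auto simp: eventually_sequentially)
  define m where "m n = \<lfloor>(C + 2) * d * exp (a * real n)\<rfloor>" for n :: nat
  have m0: "m n \<ge> 0" for n using C(1) by (simp add: m_def)
  define B where "B n = {k :: int^'n. \<forall>i. \<bar>k $ i - 0 $ i\<bar> \<le> m n}" for n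
  define V where "V n k = {x. norm x \<le> d \<and> norm (displacement A n x - real_vec k) < \<psi> n}" for n k
  define F where "F n = (\<lambda>k. abs_torus ` V n k) ` B n" for n
  define K where "K n = ((2 * (C + 2) * d + 1) * exp (a * real n)) ^ d" for n :: nat
  define r where "r n = 4 * C * exp (- (\<beta> + b) * real n)" for n :: nat
  have finB: "finite (B n)" and cardB: "card (B n) = nat (2 * m n + 1) ^ d" for n
    unfolding B_def d_def by (rule finite_int_cube[OF m0], rule card_int_cube[OF m0])
  have diam: "dist p q \<le> r n" if n: "n \<ge> n0" and pq: "p \<in> abs_torus ` V n k" "q \<in> abs_torus ` V n k" for n p q k
  proof -
    obtain x y where xy: "p = abs_torus x" "q = abs_torus y" "x \<in> V n k" "y \<in> V n k"
      using pq by blast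
    have "displacement A n (x - y) = (displacement A n x - real_vec k) - (displacement A n y - real_vec k)"
      by (simp add: linear_diff[OF linear_displacement])
    then have "norm (displacement A n (x - y)) \<le> norm (displacement A n x - real_vec k) + norm (displacement A n y - real_vec k)"
      by (metis norm_triangle_ineq4)
    also have "\<dots> \<le> 2 * \<psi> n" using xy by (simp add: V_def)
    also have "\<dots> \<le> 2 * exp (- \<beta> * real n)" using n0[OF n] by simp
    finally have "2 * C * norm (displacement A n (x - y)) \<le> 2 * C * (2 * exp (- \<beta> * real n))"
      using C(1) by (intro mult_left_mono) auto
    then have "exp (b * real n) * norm (x - y) \<le> 4 * C * exp (- \<beta> * real n)"
      using C(3)[of n "x - y"] n0[OF n] by simp
    then have "exp (- b * real n) * (exp (b * real n) * norm (x - y)) \<le> exp (- b * real n) * (4 * C * exp (- \<beta> * real n))"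
      by (intro mult_left_mono) auto
    also have "exp (- b * real n) * (exp (b * real n) * norm (x - y)) = norm (x - y)"
      by (simp add: exp_minus)
    also have "exp (- b * real n) * (4 * C * exp (- \<beta> * real n)) = r n"
      unfolding r_def by (simp add: exp_add[symmetric] algebra_simps)
    finally show ?thesis using dist_torus_le[of x y] xy by (simp add: dist_norm)
  qed
  show ?thesis
  proof (rule hausdorff_measure_limsup_eq_0[OF s(1), where F = F and K = K and r = r and ?n0.0 = n0])
    fix p assume p: "p \<in> recurrence_set (torus_map A) \<psi>"
    obtain x where x: "p = abs_torus x" "norm x \<le> d"
      using abs_torus_unit_cube unfolding d_def by blast
    let ?I = "{n. 1 \<le> n \<and> (\<exists>k. norm (displacement A n x - real_vec k) < \<psi> n)}"
    have "infinite (?I - {..<n0})"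
      using p x mem_recurrence_set_iff by (intro Diff_infinite_finite) auto
    moreover have "?I - {..<n0} \<subseteq> {n. p \<in> \<Union>(F n)}"
    proof
      fix n assume "n \<in> ?I - {..<n0}"
      then obtain k where k: "norm (displacement A n x - real_vec k) < \<psi> n" and n: "n \<ge> n0" by auto
      have "norm (real_vec k) \<le> norm (displacement A n x) + norm (displacement A n x - real_vec k)"
        using norm_triangle_ineq4[of "displacement A n x" "displacement A n x - real_vec k"] by simp
      also have "\<dots> \<le> (C + 1) * exp (a * real n) * d + 1"
      proof (intro add_mono)
        have "(C + 1) * exp (a * real n) * norm x \<le> (C + 1) * exp (a * real n) * d"
          using x C(1) by (intro mult_left_mono) auto
        then show "norm (displacement A n x) \<le> (C + 1) * exp (a * real n) * d"
          using C(2)[of n x] by linarith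
      qed (use k n0[OF n] in linarith)
      finally have "norm (real_vec k) \<le> (C + 1) * exp (a * real n) * d + 1" .
      moreover have "1 * 1 \<le> real d * exp (a * real n)"
        using d a by (intro mult_mono) auto
      moreover have "(C + 2) * d * exp (a * real n) = (C + 1) * exp (a * real n) * d + d * exp (a * real n)"
        by (simp add: algebra_simps)
      ultimately have nk: "norm (real_vec k) \<le> (C + 2) * d * exp (a * real n)" by linarith
      have "\<bar>k $ i\<bar> \<le> m n" for i
      proof -
        have "real_of_int \<bar>k $ i\<bar> \<le> (C + 2) * d * exp (a * real n)"
          using component_le_norm_cart[of "real_vec k" i] nk by (simp add: real_vec_def)
        then show ?thesis unfolding m_def by (simp only: le_floor_iff)
      qed
      then have "k \<in> B n" by (simp add: B_def)
      moreover have "x \<in> V n k" using x k by (simp add: V_def)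
      ultimately show "n \<in> {n. p \<in> \<Union>(F n)}" using x(1) by (auto simp: F_def)
    qed
    ultimately show "infinite {n. p \<in> \<Union>(F n)}" using infinite_super by blast
  next
    fix n assume n: "n \<ge> n0"
    show "finite (F n)" using finB by (simp add: F_def)
    have "real (card (F n)) \<le> real (nat (2 * m n + 1)) ^ d"
      using card_image_le[OF finB, of "\<lambda>k. abs_torus ` V n k" n] cardB[of n]
      by (metis F_def of_nat_le_iff of_nat_power)
    also have "\<dots> \<le> K n"
      unfolding K_def
    proof (rule power_mono)
      have "real (nat (2 * m n + 1)) = 2 * real_of_int (m n) + 1" using m0[of n] by simp
      also have "\<dots> \<le> 2 * ((C + 2) * d * exp (a * real n)) + exp (a * real n)"
        unfolding m_def using a by (intro add_mono mult_left_mono of_int_floor_le) auto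
      finally show "real (nat (2 * m n + 1)) \<le> (2 * (C + 2) * d + 1) * exp (a * real n)"
        by (simp add: algebra_simps)
    qed simp
    finally show "real (card (F n)) \<le> K n" .
    fix W assume "W \<in> F n"
    then obtain k where W: "W = abs_torus ` V n k" by (auto simp: F_def)
    have r0: "0 \<le> r n" using C(1) by (simp add: r_def)
    show "bounded W \<and> diameter W \<le> r n"
      using diam[OF n, of _ k] r0 unfolding W
      by (auto simp: bounded_two_points diameter_def intro!: cSUP_least exI[of _ "r n"])
  next
    show "0 \<le> r n" for n using C(1) by (simp add: r_def)
    show "r \<longlonglongrightarrow> 0"
      using tendsto_mult_right_zero[OF tendsto_exp_neg[OF \<beta>b], of "4 * C"] by (simp add: r_def[abs_def])
    have "K n * r n powr s = (2 * (C + 2) * d + 1) ^ d * (4 * C) powr s * exp (- \<kappa> * real n)" for n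
    proof -
      have "exp (a * real n) ^ d * exp (- (\<beta> + b) * real n) powr s = exp (- \<kappa> * real n)"
        unfolding exp_powr exp_of_nat_mult[symmetric] exp_add[symmetric]
        by (simp add: \<kappa>_def algebra_simps)
      then show ?thesis
        using C(1) by (simp only: K_def r_def power_mult_distrib powr_mult) (simp add: mult_ac)
    qed
    then show "summable (\<lambda>n. K n * r n powr s)"
      using summable_mult[OF summable_exp_neg[OF \<kappa>]] by simp
  qed
qed

section \<open>The lower bound\<close>

text \<open>
  Every integer vector k is attained by A^n - I, and thus gives a point of period n.
\<close>
lemma surj_displacement:
  fixes A :: "int^'n^'n"
  assumes "\<And>v. exp b * norm v \<le> C * norm (displacement A n v)"
  shows "surj (displacement A n)"
proof -
  have "v = 0" if "displacement A n v = 0" for v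
    using assms[of v] that by (simp add: mult_le_0_iff)
  then have "inj (displacement A n)"
    using linear_inj_iff_eq_0[OF linear_displacement] by blast
  then show ?thesis by (rule linear_inj_imp_surj[OF linear_displacement])
qed

text \<open>
  The centres P n are the lifted points of period n. Density: given y, round (A^n - I) y to an integer
  vector and solve for q; the expansion of A^n - I makes y - q small. Closeness: A^n - I stretches a
  ball of radius \<rho> n around q by at most (C + 1) e^(an), hence to size e^(- \<beta> n) < \<psi> n.
\<close>
lemma hausdorff_measure_recurrence_set_neq_0:
  fixes A :: "int^'n^'n"
  assumes eig: "\<And>c. complex_eigenvalue A c \<Longrightarrow> cmod c = lam" and "1 < lam"
    and psi: "infinite {n. exp (- \<beta> * real n) < \<psi> n}" and "0 < \<beta>"
    and s: "0 < s" "s < real CARD('n)" "s * (\<beta> + ln lam) < real CARD('n) * ln lam"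
  shows "hausdorff_measure s (recurrence_set (torus_map A) \<psi>) \<noteq> 0"
proof
  assume null: "hausdorff_measure s (recurrence_set (torus_map A) \<psi>) = 0"
  define d where "d = CARD('n)"
  have d: "d \<ge> 1" by (simp add: d_def Suc_leI)
  define L where "L = ln lam"
  have L: "0 < L" using \<open>1 < lam\<close> by (simp add: L_def)
  define \<eta> where "\<eta> = d * L - s * (\<beta> + L)"
  have \<eta>: "\<eta> > 0" using s by (simp add: \<eta>_def d_def L_def)
  obtain \<epsilon> where \<epsilon>: "0 < \<epsilon>" "\<epsilon> \<le> L / 2" "\<epsilon> * (d + s) < \<eta>"
    using small_perturbation[OF \<eta> L, of "d + s"] s d by auto
  have ab: "s * (\<beta> + (L + \<epsilon>)) < d * (L - \<epsilon>)" using \<epsilon>(3) by (simp add: \<eta>_def algebra_simps)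
  define a where "a = L + \<epsilon>"
  define b where "b = L - \<epsilon>"
  have a: "0 < a" "ln lam < a" "b < a" and b: "0 < b" "b < ln lam"
    using \<epsilon> L by (auto simp: a_def b_def L_def)
  define \<kappa> where "\<kappa> = d * b - s * (\<beta> + a)"
  have \<kappa>: "0 < \<kappa>" using ab by (simp add: \<kappa>_def a_def b_def)
  obtain C n0 where C: "C \<ge> 1"
    "\<And>n v. norm (displacement A n v) \<le> (C + 1) * exp (a * real n) * norm v"
    "\<And>n v. n \<ge> n0 \<Longrightarrow> exp (b * real n) * norm v \<le> 2 * C * norm (displacement A n v)"
    using displacement_bounds[OF eig \<open>1 < lam\<close> b a(2)] by blast
  define S where "S = {n. exp (- \<beta> * real n) < \<psi> n} - {..<max 1 n0}"
  have S: "infinite S" unfolding S_def using psi by (intro Diff_infinite_finite) auto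
  have S_D: "exp (- \<beta> * real n) < \<psi> n" "n \<ge> 1" "n \<ge> n0" if "n \<in> S" for n
    using that by (auto simp: S_def)
  define P where "P n = {q. \<exists>k. displacement A n q = real_vec k}" for n
  define G where "G n = {x. 1 \<le> n \<and> (\<exists>k. norm (displacement A n x - real_vec k) < \<psi> n)}" for n
  define \<delta> where "\<delta> n = 8 * C * d * exp (- b * real n)" for n :: nat
  define \<rho> where "\<rho> n = exp (- (\<beta> + a) * real n) / (C + 1)" for n :: nat
  have dense: "\<exists>q\<in>P n. dist y q \<le> \<delta> n / 4" if n: "n \<in> S" for n y
  proof -
    define k :: "int^'n" where "k = (\<chi> i. \<lfloor>displacement A n y $ i\<rfloor>)"
    obtain q where q: "displacement A n q = real_vec k"
      using surj_displacement[OF C(3)[OF S_D(3)[OF n]]] by (metis surjD)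
    have "norm (displacement A n (y - q)) = norm (displacement A n y - real_vec k)"
      by (simp add: linear_diff[OF linear_displacement] q)
    also have "\<dots> \<le> (\<Sum>i\<in>UNIV. \<bar>(displacement A n y - real_vec k) $ i\<bar>)" by (rule norm_le_l1_cart)
    also have "\<dots> \<le> (\<Sum>i\<in>(UNIV::'n set). 1)"
    proof (intro sum_mono)
      fix i
      have "(displacement A n y - real_vec k) $ i = frac (displacement A n y $ i)"
        by (simp add: k_def real_vec_def frac_def)
      then show "\<bar>(displacement A n y - real_vec k) $ i\<bar> \<le> 1" by (simp add: frac_lt_1 less_imp_le)
    qed
    finally have "2 * C * norm (displacement A n (y - q)) \<le> 2 * C * d"
      using C(1) by (intro mult_left_mono) (auto simp: d_def)
    then have "exp (b * real n) * norm (y - q) \<le> 2 * C * d"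
      using C(3)[OF S_D(3)[OF n], of "y - q"] by linarith
    then have "norm (y - q) \<le> 2 * C * d * exp (- b * real n)"
      by (simp add: exp_minus field_simps)
    then show ?thesis using q by (intro bexI[of _ q]) (auto simp: P_def \<delta>_def dist_norm)
  qed
  have close: "cball q (\<rho> n) \<subseteq> G n" if n: "n \<in> S" and q: "q \<in> P n" for n q
  proof
    fix x assume "x \<in> cball q (\<rho> n)"
    then have x: "norm (x - q) \<le> \<rho> n" by (simp add: dist_norm norm_minus_commute)
    obtain k where k: "displacement A n q = real_vec k" using q by (auto simp: P_def)
    have "norm (displacement A n x - real_vec k) = norm (displacement A n (x - q))"
      by (simp add: linear_diff[OF linear_displacement] k)
    also have "\<dots> \<le> (C + 1) * exp (a * real n) * norm (x - q)" by (rule C)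
    also have "\<dots> \<le> (C + 1) * exp (a * real n) * \<rho> n"
      using x C(1) by (intro mult_left_mono) auto
    also have "\<dots> = exp (a * real n) * exp (- (\<beta> + a) * real n)"
      using C(1) by (simp add: \<rho>_def)
    also have "\<dots> = exp (- \<beta> * real n)" by (simp add: exp_add[symmetric] algebra_simps)
    also have "\<dots> < \<psi> n" by (rule S_D(1)[OF n])
    finally show "x \<in> G n" using S_D(2)[OF n] by (auto simp: G_def)
  qed
  have pos: "0 < \<delta> n" "0 < \<rho> n" for n using C(1) d by (auto simp: \<delta>_def \<rho>_def)
  have lim1: "\<delta> \<longlonglongrightarrow> 0"
    using tendsto_mult_right_zero[OF tendsto_exp_neg[OF b(1)], of "8 * C * d"] by (simp add: \<delta>_def[abs_def])
  have ratio: "\<rho> n / \<delta> n = 1 / ((C + 1) * (8 * C * d)) * exp (- (\<beta> + a - b) * real n)" for n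
  proof -
    have "exp (- (\<beta> + a) * real n) = exp (- (\<beta> + a - b) * real n) * exp (- b * real n)"
      by (simp add: exp_add[symmetric] algebra_simps)
    then show ?thesis by (simp add: \<rho>_def \<delta>_def)
  qed
  have "0 < \<beta> + a - b" using a \<open>0 < \<beta>\<close> by simp
  then have lim2: "(\<lambda>n. \<rho> n / \<delta> n) \<longlonglongrightarrow> 0"
    unfolding ratio by (rule tendsto_mult_right_zero[OF tendsto_exp_neg])
  have "\<delta> n ^ d / \<rho> n powr s = (8 * C * d) ^ d * (C + 1) powr s * exp (- \<kappa> * real n)" for n
  proof -
    have "exp (- b * real n) ^ d = exp (- \<kappa> * real n) * exp (- (\<beta> + a) * real n) powr s"
      unfolding exp_powr exp_of_nat_mult[symmetric] exp_add[symmetric]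
      by (simp add: \<kappa>_def algebra_simps)
    then show ?thesis
      using C(1) by (simp add: \<delta>_def \<rho>_def power_mult_distrib powr_divide)
  qed
  then have lim3: "(\<lambda>n. \<delta> n ^ d / \<rho> n powr s) \<longlonglongrightarrow> 0"
    using tendsto_mult_right_zero[OF tendsto_exp_neg[OF \<kappa>]] by simp

  \<comment> \<open>The constant c is chosen so that the requirement of the escape lemma holds with equality.\<close>
  define M where "M = (10 * real d) ^ d"
  have M: "M > 1" unfolding M_def using d by (intro one_less_power) auto
  define c where "c = (1 / M) powr (s / (d - s))"
  have sd: "s < d" using s by (simp add: d_def)
  have "(1 / M) powr (s / (d - s)) < 1 powr (s / (d - s))"
    using M s sd by (intro powr_less_mono2) auto
  then have c: "0 < c" "c < 1" using M by (auto simp: c_def)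
  have "c powr ((d - s) / s) = 1 / M" using M s sd by (simp add: c_def powr_powr)
  then have Mc: "M * c powr ((d - s) / s) \<le> 1" using M by simp

  define e where "e = c * (1 / 4) powr s / 2"
  have e: "e > 0" using c by (simp add: e_def)
  obtain U :: "nat \<Rightarrow> 'n torus set" where U: "recurrence_set (torus_map A) \<psi> \<subseteq> (\<Union>i. U i)"
    "\<And>i. bounded (U i)" "(\<Sum>i. ennreal (diameter_powr s (U i))) < ennreal e"
    using hausdorff_measure_eq_0_cover[OF null e] by blast
  define w where "w i = diameter_powr s (U i)" for i
  have w0: "0 \<le> w i" for i by (simp add: w_def diameter_powr_nonneg)
  have "(\<Sum>i. ennreal (w i)) < top"
    unfolding w_def using U(3) ennreal_less_top by (rule order_less_trans)
  then have sum_w: "summable w"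
    using w0 by (intro summable_suminf_not_top) auto
  have "ennreal (suminf w) < ennreal e"
    using suminf_ennreal2[OF w0 sum_w] U(3) by (simp add: w_def[abs_def])
  then have w_e: "suminf w < e" using e by (simp add: ennreal_less_iff suminf_nonneg[OF sum_w w0])
  \<comment> \<open>The sets of the cover may have diameter 0, but the escape lemma needs positive D i; the
      summable enlargement costs at most a total weight of e.\<close>
  define D where "D i = (w i + e * (1 / 2) ^ Suc i) powr (1 / s)" for i
  have w_pos: "0 < w i + e * (1 / 2) ^ Suc i" for i using w0[of i] e by (intro add_nonneg_pos) auto
  have D_s: "D i powr s = w i + e * (1 / 2) ^ Suc i" for i
    unfolding D_def powr_powr using s w_pos[of i] by simp
  have D_pos: "0 < D i" for i unfolding D_def powr_gt_zero using w_pos[of i] by simp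
  have half: "(\<lambda>i. e * (1 / 2) ^ Suc i) sums e"
    using sums_mult[OF power_half_series, of e] by simp
  have sum_D: "(\<lambda>i. D i powr s) sums (suminf w + e)"
    unfolding D_s by (intro sums_add half summable_sums sum_w)
  \<comment> \<open>In a ball of radius 1/4 distances in the torus and upstairs agree, so the cover lifts.\<close>
  define U' where "U' i = {x \<in> cball 0 (1 / 4). abs_torus x \<in> U i}" for i
  have U'_D: "dist x y \<le> D i" if "x \<in> U' i" "y \<in> U' i" for i x y
  proof -
    have "dist x y \<le> 1 / 2" using that dist_triangle[of x y 0] by (simp add: U'_def dist_commute)
    then have "dist x y = dist (abs_torus x) (abs_torus y)" by (simp add: dist_abs_torus_eq)
    also have "\<dots> \<le> diameter (U i)" using that U(2) by (intro diameter_bounded_bound) (auto simp: U'_def)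
    also have "\<dots> \<le> D i"
    proof (rule ccontr)
      assume "\<not> diameter (U i) \<le> D i"
      then have "D i powr s < diameter (U i) powr s"
        using s D_pos[of i] by (intro powr_less_mono2) auto
      also have "\<dots> = w i" using that s by (auto simp: w_def diameter_powr_def U'_def)
      finally have "D i powr s < w i" .
      moreover have "0 < e * (1 / 2) ^ Suc i" using e by simp
      ultimately show False using D_s[of i] by linarith
    qed
    finally show ?thesis .
  qed
  have "\<exists>x\<in>cball 0 (1 / 4). infinite {n. x \<in> G n} \<and> (\<forall>i. x \<notin> U' i)"
  proof (rule limsup_escapes_cover[OF s(1,2) c _ S, where P = P and \<delta> = \<delta> and \<rho> = \<rho> and D = D])
    show "(10 * real CARD('n)) ^ CARD('n) * c powr ((real CARD('n) - s) / s) \<le> 1"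
      using Mc by (simp add: M_def d_def)
    show "(\<lambda>n. \<delta> n ^ CARD('n) / \<rho> n powr s) \<longlonglongrightarrow> 0" using lim3 by (simp add: d_def)
    show "(\<Sum>i. D i powr s) \<le> c * (1 / 4) powr s"
      using sums_unique[OF sum_D] w_e by (simp add: e_def)
    show "summable (\<lambda>i. D i powr s)" using sum_D by (rule sums_summable)
  qed (use dense close pos lim1 lim2 U'_D D_pos in auto)
  then obtain x where x: "x \<in> cball 0 (1 / 4)" "infinite {n. x \<in> G n}" "\<And>i. x \<notin> U' i"
    by blast
  have "abs_torus x \<in> recurrence_set (torus_map A) \<psi>"
    using x(2) by (simp add: mem_recurrence_set_iff G_def)
  then obtain i where "abs_torus x \<in> U i" using U(1) by blast
  then show False using x(1) x(3)[of i] by (simp add: U'_def)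
qed

section \<open>The Hausdorff dimension\<close>

lemma liminf_log_nonneg:
  fixes \<psi> :: "nat \<Rightarrow> real"
  assumes "\<And>n. n \<ge> 1 \<Longrightarrow> 0 < \<psi> n" "\<psi> \<longlonglongrightarrow> 0"
  shows "0 \<le> liminf (\<lambda>n. ereal (- ln (\<psi> n) / real n))"
proof (rule Liminf_bounded)
  show "\<forall>\<^sub>F n in sequentially. 0 \<le> ereal (- ln (\<psi> n) / real n)"
    using order_tendstoD(2)[OF assms(2) zero_less_one] eventually_ge_at_top[of 1]
  proof eventually_elim
    case (elim n)
    then have "ln (\<psi> n) \<le> 0" using assms(1)[of n] by simp
    then show ?case using elim by (simp add: divide_nonpos_nonneg)
  qed
qed

lemma log_rate_less_iff:
  fixes p :: real
  assumes "0 < p" "0 < n"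
  shows "\<beta> < - ln p / real n \<longleftrightarrow> p < exp (- \<beta> * real n)"
proof -
  have "\<beta> < - ln p / real n \<longleftrightarrow> ln p < - \<beta> * real n"
    using pos_less_divide_eq[of "real n" \<beta> "- ln p"] assms(2) by (simp del: divide_minus_left) linarith
  also have "\<dots> \<longleftrightarrow> p < exp (- \<beta> * real n)" using assms by (metis exp_less_cancel_iff exp_ln)
  finally show ?thesis .
qed

lemma hausdorff_measure_empty: "hausdorff_measure s ({} :: 'a::metric_space set) = 0"
proof -
  have "hausdorff_premeasure s \<delta> ({} :: 'a set) \<le> 0" if "\<delta> > 0" for \<delta>
    unfolding hausdorff_premeasure_def
    by (rule INF_lower2[of "\<lambda>_. {}"]) (use that in \<open>auto simp: diameter_powr_def\<close>)
  then show ?thesis unfolding hausdorff_measure_def by (auto intro: antisym SUP_least)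
qed

theorem corollary1p4:
  fixes A :: "int^'n^'n"
    and lam :: real
    and \<psi> :: "nat \<Rightarrow> real"
    and \<alpha> :: ereal
  assumes "\<And>c. complex_eigenvalue A c \<Longrightarrow> cmod c = lam"
    and "lam > 1"
    and "\<And>n. n \<ge> 1 \<Longrightarrow> \<psi> n > 0"
    and "antimono_on {1..} \<psi>"
    and "\<psi> \<longlonglongrightarrow> 0"
    and "\<alpha> = liminf (\<lambda>n. ereal (- ln (\<psi> n) / real n))"
  shows "hausdorff_dim (recurrence_set (torus_map A) \<psi>)
           = ereal (real CARD('n) * ln lam) / (\<alpha> + ereal (ln lam))"
proof -
  let ?R = "recurrence_set (torus_map A) \<psi>"
  define d where "d = real CARD('n)"
  have d: "d > 0" by (simp add: d_def)
  define L where "L = ln lam"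
  have L: "L > 0" using assms(2) by (simp add: L_def)
  have \<alpha>0: "0 \<le> \<alpha>" unfolding assms(6) using assms(3,5) by (rule liminf_log_nonneg)
  \<comment> \<open>The condition on s says d L < s (\<alpha> + L) in a form that also makes sense for infinite \<alpha>.\<close>
  have upper: "hausdorff_measure s ?R = 0" if s: "0 < s" "ereal (d * L / s - L) < \<alpha>" for s
  proof -
    obtain \<beta> where \<beta>: "d * L / s - L < \<beta>" "ereal \<beta> < \<alpha>" using ereal_dense2[OF s(2)] by auto
    have "\<forall>\<^sub>F n in sequentially. ereal \<beta> < ereal (- ln (\<psi> n) / real n)"
      using \<beta>(2) unfolding assms(6) by (rule less_LiminfD)
    then have "\<forall>\<^sub>F n in sequentially. \<psi> n \<le> exp (- \<beta> * real n)"
      using eventually_ge_at_top[of 1]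
      by eventually_elim (use assms(3) log_rate_less_iff in \<open>auto intro: less_imp_le\<close>)
    then show ?thesis
      using assms(1,2,5) s \<beta> by (intro hausdorff_measure_recurrence_set_eq_0[where \<beta> = \<beta> and lam = lam])
        (auto simp: d_def L_def field_simps)
  qed
  have lower: "hausdorff_measure s ?R \<noteq> 0" if s: "0 < s" "s < d" "\<alpha> < ereal (d * L / s - L)" for s
  proof -
    obtain \<beta> where \<beta>: "\<alpha> < ereal \<beta>" "\<beta> < d * L / s - L" using ereal_dense2[OF s(3)] by auto
    have "infinite {n. exp (- \<beta> * real n) < \<psi> n}"
    proof
      assume "finite {n. exp (- \<beta> * real n) < \<psi> n}"
      then have "\<forall>\<^sub>F n in sequentially. \<not> exp (- \<beta> * real n) < \<psi> n"
        by (simp add: cofinite_eq_sequentially[symmetric] eventually_cofinite)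
      then have "\<forall>\<^sub>F n in sequentially. ereal \<beta> \<le> ereal (- ln (\<psi> n) / real n)"
        using eventually_ge_at_top[of 1]
      proof eventually_elim
        case (elim n)
        then have "ln (\<psi> n) \<le> - \<beta> * real n"
          using assms(3)[of n] by (metis exp_le_cancel_iff exp_ln not_less)
        then show ?case using elim by (simp add: field_simps)
      qed
      then have "ereal \<beta> \<le> \<alpha>" unfolding assms(6) by (rule Liminf_bounded)
      then show False using \<beta>(1) by simp
    qed
    moreover have "0 < \<beta>" using \<alpha>0 \<beta>(1) by (metis ereal_less(2) order_le_less_trans)
    ultimately show ?thesis
      using assms(1,2) s \<beta> by (intro hausdorff_measure_recurrence_set_neq_0[where \<beta> = \<beta> and lam = lam])
        (auto simp: d_def L_def field_simps)
  qed
  obtain t where t: "0 \<le> t" "ereal (d * L) / (\<alpha> + ereal L) = ereal t"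
    and t_lower: "\<And>s. 0 < s \<Longrightarrow> s < t \<Longrightarrow> s < d \<and> \<alpha> < ereal (d * L / s - L)"
    and t_upper: "\<And>s. t < s \<Longrightarrow> ereal (d * L / s - L) < \<alpha>"
  proof (cases \<alpha>)
    case (real r)
    have r: "0 \<le> r" using \<alpha>0 real by simp
    show ?thesis
    proof (rule that[of "d * L / (r + L)"])
      show "ereal (d * L) / (\<alpha> + ereal L) = ereal (d * L / (r + L))" using real r L by simp
      show "0 \<le> d * L / (r + L)" using r L d by simp
      fix s
      show "s < d \<and> \<alpha> < ereal (d * L / s - L)" if s: "0 < s" "s < d * L / (r + L)"
      proof
        have "d * L / (r + L) \<le> d" using r L d by (simp add: field_simps)
        then show "s < d" using s by simp
        show "\<alpha> < ereal (d * L / s - L)" using s r L real by (simp add: field_simps)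
      qed
      show "ereal (d * L / s - L) < \<alpha>" if s: "d * L / (r + L) < s"
      proof -
        have "0 < s" using s r L d by (meson add_nonneg_pos divide_nonneg_pos le_less_trans less_imp_le mult_nonneg_nonneg)
        then show ?thesis using s r L real by (simp add: field_simps)
      qed
    qed
  next
    case PInf
    then show ?thesis by (intro that[of 0]) auto
  qed (use \<alpha>0 in simp)
  have "hausdorff_dim ?R = ereal t"
  proof (rule antisym)
    show "hausdorff_dim ?R \<le> ereal t"
    proof (rule ereal_le_epsilon2)
      fix e :: real assume "0 < e"
      then have "hausdorff_measure (t + e) ?R = 0" using upper[of "t + e"] t_upper[of "t + e"] t(1) by simp
      then show "hausdorff_dim ?R \<le> ereal t + ereal e"
        unfolding hausdorff_dim_def using t(1) \<open>0 < e\<close> by (intro Inf_lower) auto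
    qed
    show "ereal t \<le> hausdorff_dim ?R"
      unfolding hausdorff_dim_def
    proof (rule Inf_greatest, safe)
      fix s :: real assume s: "0 \<le> s" "hausdorff_measure s ?R = 0"
      show "ereal t \<le> ereal s"
      proof (rule ccontr)
        assume "\<not> ereal t \<le> ereal s"
        then have st: "s < t" by simp
        show False
        \<comment> \<open>In dimension 0 only the empty set is null, and it is null in all dimensions.\<close>
        proof (cases "s = 0")
          case True
          then have "?R = {}" using s hausdorff_measure_0_eq_0 by blast
          then have "hausdorff_measure (t / 2) ?R = 0" by (simp add: hausdorff_measure_empty)
          then show False using lower[of "t / 2"] t_lower[of "t / 2"] st s by simp
        next
          case False
          then show False using lower[of s] t_lower[of s] st s by simp
        qed
      qed
    qed
  qed
  then show ?thesis using t(2) by (simp add: d_def L_def)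
qed

end
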